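(* Let $G$ be a virtually abelian group, let $S$ be any finite generating set of $G$, and let $\omega\colon S\to\{1,2,3,\ldots\}$ be any weight function. Then the weighted conjugacy growth series of $G$ with respect to $S$, $$\sum_{n=0}^{\infty}\#\{c\mid c\text{ is a conjugacy class of }G,\ \omega(c)=n\}\,z^n,$$ is a rational function.
   Context: A finite generating set $S$ of $G$ means a finite subset $S\subseteq G$ generating $G$ as a monoid; $S^*$ is the set of all finite words over $S$ (including the empty word). The weight of a word is $\omega(s_1s_2\cdots s_k)=\sum_{i=1}^k\omega(s_i)$, and the weight $\omega(g)$ of $g\in G$ is the minimal weight amongst all words in $S^*$ that represent $g$. The weight of a conjugacy class $c$ is $\omega(c)=\min\{\omega(g)\mid g\in c\}$, i.e. the minimal weight of a word representing an element of the class. A formal power series is a rational function if it equals $p(z)/q(z)$ for some polynomials $p,q$ with integer coefficients. *)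

theory Defs
  imports
    "HOL-Algebra.Group_Action"
    "HOL-Computational_Algebra.Polynomial_FPS"
    "HOL-Computational_Algebra.Fraction_Field"
begin

definition virtually_abelian :: "('a, 'b) monoid_scheme \<Rightarrow> bool" where
  "virtually_abelian G \<longleftrightarrow>
     (\<exists>H. subgroup H G \<and> comm_group (G\<lparr>carrier := H\<rparr>) \<and> finite (rcosets\<^bsub>G\<^esub> H))"

definition word_value :: "('a, 'b) monoid_scheme \<Rightarrow> 'a list \<Rightarrow> 'a" where
  "word_value G w = foldr (\<otimes>\<^bsub>G\<^esub>) w \<one>\<^bsub>G\<^esub>"

text \<open>Generation is as a monoid: inverses of generators are not allowed as letters.\<close>

definition finite_generating_set :: "('a, 'b) monoid_scheme \<Rightarrow> 'a set \<Rightarrow> bool" where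
  "finite_generating_set G S \<longleftrightarrow>
     finite S \<and> S \<subseteq> carrier G \<and> (\<forall>g \<in> carrier G. \<exists>w \<in> lists S. word_value G w = g)"

definition word_weight :: "('a \<Rightarrow> nat) \<Rightarrow> 'a list \<Rightarrow> nat" where
  "word_weight \<omega> w = sum_list (map \<omega> w)"

text \<open>
  When \<open>S\<close> generates \<open>G\<close>, the infima below are taken over nonempty sets of
  natural numbers, so they are minima.
\<close>

definition elem_weight :: "('a, 'b) monoid_scheme \<Rightarrow> 'a set \<Rightarrow> ('a \<Rightarrow> nat) \<Rightarrow> 'a \<Rightarrow> nat" where
  "elem_weight G S \<omega> g = (INF w \<in> {w \<in> lists S. word_value G w = g}. word_weight \<omega> w)"

definition conjugacy_classes :: "('a, 'b) monoid_scheme \<Rightarrow> 'a set set" where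
  "conjugacy_classes G =
     orbits G (carrier G) (\<lambda>g. \<lambda>h \<in> carrier G. g \<otimes>\<^bsub>G\<^esub> h \<otimes>\<^bsub>G\<^esub> inv\<^bsub>G\<^esub> g)"

definition class_weight :: "('a, 'b) monoid_scheme \<Rightarrow> 'a set \<Rightarrow> ('a \<Rightarrow> nat) \<Rightarrow> 'a set \<Rightarrow> nat" where
  "class_weight G S \<omega> c = (INF g \<in> c. elem_weight G S \<omega> g)"

text \<open>
  Since \<open>card\<close> of an infinite set is \<open>0\<close>, the coefficients are meaningful only if there are finitely
  many classes of each weight. This holds if \<open>S\<close> is a finite generating set and \<open>\<omega>\<close> is positive on
  \<open>S\<close>: then only finitely many words have a given weight, and every class of weight \<open>n\<close> contains an
  element represented by a word of weight \<open>n\<close>.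
\<close>

definition conjugacy_growth_series ::
    "('a, 'b) monoid_scheme \<Rightarrow> 'a set \<Rightarrow> ('a \<Rightarrow> nat) \<Rightarrow> int fps" where
  "conjugacy_growth_series G S \<omega> =
     Abs_fps (\<lambda>n. int (card {c \<in> conjugacy_classes G. class_weight G S \<omega> c = n}))"

text \<open>
  The quotient \<open>p / q\<close> is taken in the fraction field of the integral domain of integer power series,
  because division on \<^typ>\<open>int fps\<close> itself is not an honest quotient.
\<close>

definition rational_fps :: "int fps \<Rightarrow> bool" where
  "rational_fps F \<longleftrightarrow>
     (\<exists>p q :: int poly. q \<noteq> 0 \<and> Fract F 1 = Fract (fps_of_poly p) (fps_of_poly q))"

end

theory Submission
  imports Defs
    "HOL-Library.Function_Algebras"
    "HOL-Library.Fun_Lexorder"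
    "HOL-Algebra.FiniteProduct"
    "HOL-Algebra.Elementary_Groups"
begin

text \<open>
  Let \<open>A\<close> be an abelian normal subgroup of finite index. Cutting out loops in the Cayley graph of
  \<open>G/A\<close> shows that the pairs (value of a word, bound on its weight) form finitely many translates
  \<open>M u\<close>, where \<open>u\<close> is a short word and \<open>M\<close> a finitely generated submonoid of \<open>A \<times> \<int>\<close>.

  The \<open>A\<close>-conjugacy classes inside a coset \<open>A b\<close> are the elements of a quotient of \<open>A\<close>, and the finite
  group \<open>G/A\<close> permutes all \<open>A\<close>-classes, its orbits being the conjugacy classes of \<open>G\<close>. By Burnside's
  lemma it suffices to count the \<open>A\<close>-classes of weight at most \<open>n\<close> (up to conjugation) fixed by a given
  element of \<open>G/A\<close>. In each coset these are the elements of degree \<open>n\<close> in a finite union of sets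
  \<open>C + M\<close> in a graded abelian group (\<open>C\<close> finite, \<open>M\<close> a submonoid generated by finitely many elements of
  positive degree), intersected with a coset of a subgroup.

  By Dickson's lemma, sets of the form \<open>C + M\<close> are closed under intersection with each other and with
  cosets. So inclusion-exclusion reduces the count to a single \<open>C + M\<close>. There the lexicographically least
  representatives form the complement of an up-closed set in some \<open>\<nat>\<^sup>k\<close>, and inclusion-exclusion over the
  orthants whose union is the up-closed set shows rationality.
\<close>

section \<open>Rational counting functions\<close>

text \<open>Minimal weights are hard to handle algebraically, while having some word of weight at
  most n is an existential condition that survives products, projections and conjugation. Hence
  everything is counted cumulatively, and a factor 1 - z restores the series at the end.

  A loop in a word contributes a conjugate lying in A, and as A is abelian this conjugate depends
  only on the coset where the loop starts. So a loop cut out at one passage through a coset can be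
  put back at any other, but only into words that do pass through that coset. Cutting must therefore
  not shrink the set of visited cosets; this is why that set is part of the state, and why every
  short word has a monoid of its own.

  The quotient of A that describes the A-classes in A b depends on b and may have torsion, and
  generators satisfy relations. Elements then have several exponent vectors, which forces the choice
  of least ones. Finally, orbits of G/A on A-classes differ in size, so they cannot be counted by a
  single division; Burnside replaces them by fixed points, and being fixed by t is a coset
  condition.\<close>

lemma rational_fps_iff:
  "rational_fps F \<longleftrightarrow> (\<exists>p q. q \<noteq> 0 \<and> F * fps_of_poly q = fps_of_poly p)"
proof -
  have "Fract F 1 = Fract (fps_of_poly p) (fps_of_poly q) \<longleftrightarrow> F * fps_of_poly q = fps_of_poly p"
    if "q \<noteq> 0" for p q :: "int poly"
    using that by (simp add: eq_fract)
  then show ?thesis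
    unfolding rational_fps_def by blast
qed

lemma rational_fps_of_poly [simp]: "rational_fps (fps_of_poly p)"
  unfolding rational_fps_iff by (rule exI[of _ p], rule exI[of _ 1]) simp

lemma rational_fps_0 [simp]: "rational_fps 0"
  using rational_fps_of_poly[of 0] by simp

lemma rational_fps_add:
  assumes "rational_fps F" "rational_fps H"
  shows "rational_fps (F + H)"
proof -
  obtain p q p' q' where *: "q \<noteq> 0" "q' \<noteq> 0" "F * fps_of_poly q = fps_of_poly p"
      "H * fps_of_poly q' = fps_of_poly p'"
    using assms unfolding rational_fps_iff by metis
  have "(F + H) * fps_of_poly (q * q')
      = (F * fps_of_poly q) * fps_of_poly q' + (H * fps_of_poly q') * fps_of_poly q"
    by (simp add: fps_of_poly_mult algebra_simps)
  also have "\<dots> = fps_of_poly (p * q' + p' * q)"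
    by (simp add: * fps_of_poly_mult fps_of_poly_add)
  finally show ?thesis
    using *(1,2) unfolding rational_fps_iff by (metis mult_eq_0_iff)
qed

lemma rational_fps_mult_poly:
  assumes "rational_fps F"
  shows "rational_fps (fps_of_poly r * F)"
proof -
  obtain p q where *: "q \<noteq> 0" "F * fps_of_poly q = fps_of_poly p"
    using assms unfolding rational_fps_iff by metis
  have "fps_of_poly r * F * fps_of_poly q = fps_of_poly (r * p)"
    by (simp add: *(2) mult.assoc fps_of_poly_mult)
  then show ?thesis
    using * unfolding rational_fps_iff by blast
qed

text \<open>Provides the two divisions of the proof: by 1 - z^m for a generator of degree m, and by
  the number of cosets in Burnside's formula. An integer is a legitimate denominator because q need
  only be nonzero, not invertible as a power series.\<close>

lemma rational_fps_cancel_poly: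
  assumes "rational_fps (fps_of_poly r * F)" "r \<noteq> 0"
  shows "rational_fps F"
proof -
  obtain p q where *: "q \<noteq> 0" "fps_of_poly r * F * fps_of_poly q = fps_of_poly p"
    using assms unfolding rational_fps_iff by metis
  then have "F * fps_of_poly (r * q) = fps_of_poly p"
    by (simp add: fps_of_poly_mult mult_ac)
  then show ?thesis
    using * assms(2) unfolding rational_fps_iff by (metis mult_eq_0_iff)
qed

lemma rational_fps_diff:
  assumes "rational_fps F" "rational_fps H"
  shows "rational_fps (F - H)"
proof -
  have "rational_fps (fps_of_poly (- 1) * H)"
    using assms(2) by (rule rational_fps_mult_poly)
  then have "rational_fps (F + fps_of_poly (- 1) * H)"
    by (rule rational_fps_add[OF assms(1)])
  then show ?thesis
    by (simp add: fps_of_poly_uminus)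
qed

lemma rational_fps_sum:
  assumes "\<And>i. i \<in> I \<Longrightarrow> rational_fps (F i)"
  shows "rational_fps (\<Sum>i\<in>I. F i)"
  using assms by (induction I rule: infinite_finite_induct) (auto intro: rational_fps_add)

text \<open>The finiteness of the fibres guards against the junk value of \<^const>\<open>card\<close>.\<close>

definition counting_series :: "('x \<Rightarrow> int) \<Rightarrow> 'x set \<Rightarrow> int fps" where
  "counting_series d X = Abs_fps (\<lambda>n. int (card {x \<in> X. d x = int n}))"

definition rational_count :: "('x \<Rightarrow> int) \<Rightarrow> 'x set \<Rightarrow> bool" where
  "rational_count d X \<longleftrightarrow>
     (\<forall>n :: nat. finite {x \<in> X. d x = int n}) \<and> rational_fps (counting_series d X)"

lemma rational_count_empty [simp]: "rational_count d {}"
proof -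
  have "counting_series d {} = 0"
    by (simp add: counting_series_def fps_eq_iff)
  then show ?thesis
    by (simp add: rational_count_def)
qed

lemma rational_count_finite_fibre: "rational_count d X \<Longrightarrow> finite {x \<in> X. d x = int n}"
  by (simp add: rational_count_def)

lemma rational_count_Diff:
  assumes "rational_count d X" "rational_count d Y" "Y \<subseteq> X"
  shows "rational_count d (X - Y)"
proof -
  have fin: "finite {x \<in> X - Y. d x = int n}" for n
    by (rule finite_subset[OF _ rational_count_finite_fibre[OF assms(1)]]) auto
  have "int (card {x \<in> X - Y. d x = int n}) = int (card {x \<in> X. d x = int n}) - int (card {x \<in> Y. d x = int n})"
    for n
  proof -
    have "{x \<in> X. d x = int n} = {x \<in> X - Y. d x = int n} \<union> {x \<in> Y. d x = int n}"
      using assms(3) by auto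
    moreover have "card \<dots> = card {x \<in> X - Y. d x = int n} + card {x \<in> Y. d x = int n}"
      using fin rational_count_finite_fibre[OF assms(2)] by (intro card_Un_disjoint) auto
    ultimately show ?thesis by simp
  qed
  then have "counting_series d (X - Y) = counting_series d X - counting_series d Y"
    by (simp add: counting_series_def fps_eq_iff)
  then show ?thesis
    using assms(1,2) fin by (auto simp: rational_count_def intro: rational_fps_diff)
qed

lemma rational_count_Un_disjoint:
  assumes "rational_count d X" "rational_count d Y" "X \<inter> Y = {}"
  shows "rational_count d (X \<union> Y)"
proof -
  have eq: "{x \<in> X \<union> Y. d x = int n} = {x \<in> X. d x = int n} \<union> {x \<in> Y. d x = int n}" for n
    by auto
  have "card {x \<in> X \<union> Y. d x = int n} = card {x \<in> X. d x = int n} + card {x \<in> Y. d x = int n}" for n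
    unfolding eq using assms rational_count_finite_fibre[OF assms(1)] rational_count_finite_fibre[OF assms(2)]
    by (intro card_Un_disjoint) auto
  then have "counting_series d (X \<union> Y) = counting_series d X + counting_series d Y"
    by (simp add: counting_series_def fps_eq_iff)
  then show ?thesis
    using assms(1,2) by (simp add: rational_count_def rational_fps_add eq del: Un_iff)
qed

lemma rational_count_Un:
  assumes "rational_count d X" "rational_count d Y" "rational_count d (X \<inter> Y)"
  shows "rational_count d (X \<union> Y)"
proof -
  have "rational_count d (X \<union> (Y - X \<inter> Y))"
    using assms by (intro rational_count_Un_disjoint rational_count_Diff) auto
  moreover have "X \<union> (Y - X \<inter> Y) = X \<union> Y"
    by auto
  ultimately show ?thesis
    by simp
qed

text \<open>Inclusion-exclusion two sets at a time: the union over I meets a further set E i in the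
  union of the sets E j \<inter> E i, again indexed by I and made of members of \<C>. Hence the
  induction leaves E arbitrary.\<close>

lemma rational_count_UN:
  assumes closed: "\<And>X Y. X \<in> \<C> \<Longrightarrow> Y \<in> \<C> \<Longrightarrow> X \<inter> Y \<in> \<C>"
    and rat: "\<And>X. X \<in> \<C> \<Longrightarrow> rational_count d X"
    and "finite I" "\<And>i. i \<in> I \<Longrightarrow> E i \<in> \<C>"
  shows "rational_count d (\<Union>i\<in>I. E i)"
  using assms(3,4)
proof (induction I arbitrary: E rule: finite_induct)
  case (insert i I)
  have "(\<Union>j\<in>I. E j) \<inter> E i = (\<Union>j\<in>I. E j \<inter> E i)"
    by auto
  moreover have "rational_count d (\<Union>j\<in>I. E j \<inter> E i)"
    using insert by (intro insert.IH closed) auto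
  moreover have "rational_count d (\<Union>j\<in>I. E j)"
    using insert.prems by (intro insert.IH) auto
  ultimately have "rational_count d ((\<Union>j\<in>I. E j) \<union> E i)"
    using insert.prems rat by (intro rational_count_Un) auto
  then show ?case
    by (simp add: Un_commute)
qed simp

lemma rational_count_bij:
  assumes "bij_betw h X Y" "\<And>x. x \<in> X \<Longrightarrow> d' (h x) = d x" "rational_count d X"
  shows "rational_count d' Y"
proof -
  have bij: "bij_betw h {x \<in> X. d x = int n} {y \<in> Y. d' y = int n}" for n
    using assms(1,2) unfolding bij_betw_def inj_on_def by force
  have "counting_series d' Y = counting_series d X"
    by (simp add: counting_series_def fps_eq_iff bij_betw_same_card[OF bij])
  then show ?thesis
    using assms(3) bij_betw_finite[OF bij] by (simp add: rational_count_def)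
qed

lemma fibre_shift:
  fixes d :: "'x \<Rightarrow> int"
  assumes "\<And>x. x \<in> X \<Longrightarrow> 0 \<le> d x"
  shows "{x \<in> X. d x + int m = int n} = (if m \<le> n then {x \<in> X. d x = int (n - m)} else {})"
  using assms by force

lemma rational_count_shift:
  assumes "rational_count d X" "\<And>x. x \<in> X \<Longrightarrow> 0 \<le> d x" "0 \<le> c"
  shows "rational_count (\<lambda>x. d x + c) X"
proof -
  obtain m where c: "c = int m"
    using assms(3) nonneg_int_cases by blast
  have eq: "{x \<in> X. d x + int m = int n} = (if m \<le> n then {x \<in> X. d x = int (n - m)} else {})" for n
    by (rule fibre_shift) (rule assms(2))
  have "counting_series (\<lambda>x. d x + c) X = fps_of_poly (monom 1 m) * counting_series d X"
    unfolding counting_series_def fps_of_poly_monom' fps_eq_iff c eq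
    by (simp add: fps_X_power_mult_nth not_less)
  then have "rational_fps (counting_series (\<lambda>x. d x + c) X)"
    using assms(1) by (simp add: rational_count_def rational_fps_mult_poly)
  then show ?thesis
    using rational_count_finite_fibre[OF assms(1)] by (simp add: rational_count_def c eq del: of_nat_diff)
qed

text \<open>The geometric series step. Writing F for the series, F(y X) = z^w F(X), so F(X - y X) =
  (1 - z^w) F(X), where 1 - z^w is nonzero because w \<ge> 1.\<close>

lemma rational_count_step:
  assumes fin: "\<And>n :: nat. finite {x \<in> X. d x = int n}"
    and nonneg: "\<And>x. x \<in> X \<Longrightarrow> 0 \<le> d x"
    and "y ` X \<subseteq> X" "inj_on y X"
    and deg: "\<And>x. x \<in> X \<Longrightarrow> d (y x) = d x + w" and "1 \<le> w"
    and rat: "rational_count d (X - y ` X)"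
  shows "rational_count d X"
proof -
  obtain m where m: "w = int m" "m \<ge> 1"
    using \<open>1 \<le> w\<close> by (metis nonneg_int_cases of_nat_1 of_nat_le_iff order_trans zero_le_one)
  have img: "{x \<in> y ` X. d x = int n} = y ` {x \<in> X. d x + int m = int n}" for n
    using deg m by auto
  have inj: "card (y ` {x \<in> X. d x + int m = int n}) = card {x \<in> X. d x + int m = int n}" for n
    using \<open>inj_on y X\<close> by (intro card_image) (auto simp: inj_on_def)
  have "counting_series d (y ` X) = fps_of_poly (monom 1 m) * counting_series d X"
    unfolding counting_series_def fps_of_poly_monom' fps_eq_iff img inj
    by (simp add: fps_X_power_mult_nth not_less fibre_shift nonneg)
  moreover have "counting_series d (X - y ` X) = counting_series d X - counting_series d (y ` X)"
  proof -
    have "int (card {x \<in> X. d x = int n}) = int (card {x \<in> X - y ` X. d x = int n}) + int (card {x \<in> y ` X. d x = int n})" for n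
    proof -
      have "{x \<in> X. d x = int n} = {x \<in> X - y ` X. d x = int n} \<union> {x \<in> y ` X. d x = int n}"
        using \<open>y ` X \<subseteq> X\<close> by auto
      moreover have "card \<dots> = card {x \<in> X - y ` X. d x = int n} + card {x \<in> y ` X. d x = int n}"
        using rational_count_finite_fibre[OF rat] fin[of n] \<open>y ` X \<subseteq> X\<close>
        by (intro card_Un_disjoint) (auto intro: finite_subset[rotated])
      ultimately show ?thesis by simp
    qed
    then show ?thesis
      by (simp add: counting_series_def fps_eq_iff)
  qed
  ultimately have "counting_series d (X - y ` X) = fps_of_poly (1 - monom 1 m) * counting_series d X"
    by (simp add: fps_of_poly_diff algebra_simps)
  moreover have "(1 :: int poly) - monom 1 m \<noteq> 0"
  proof
    assume "(1 :: int poly) - monom 1 m = 0"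
    then have "coeff (1 - monom 1 m :: int poly) m = 0" by simp
    then show False using m(2) by (simp add: coeff_1 split: if_splits)
  qed
  ultimately have "rational_fps (counting_series d X)"
    using rat by (metis rational_fps_cancel_poly rational_count_def)
  then show ?thesis
    using fin by (simp add: rational_count_def)
qed

section \<open>Exponent vectors\<close>

text \<open>Vectors of every length share one type, so induction on k and concatenation need no
  change of type, and sum and order are the pointwise ones of functions.\<close>

definition nvec :: "nat \<Rightarrow> (nat \<Rightarrow> nat) set" where
  "nvec k = {x. \<forall>i\<ge>k. x i = 0}"

lemma zero_in_nvec [simp]: "0 \<in> nvec k"
  by (simp add: nvec_def)

lemma add_in_nvec [simp]: "x \<in> nvec k \<Longrightarrow> y \<in> nvec k \<Longrightarrow> x + y \<in> nvec k"
  by (simp add: nvec_def)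

lemma diff_in_nvec [simp]: "x \<in> nvec k \<Longrightarrow> x - y \<in> nvec k"
  by (simp add: nvec_def)

lemma nvec_0 [simp]: "nvec 0 = {0}"
  by (auto simp: nvec_def fun_eq_iff)

lemma nvec_mono: "k \<le> l \<Longrightarrow> x \<in> nvec k \<Longrightarrow> x \<in> nvec l"
  by (simp add: nvec_def)

lemma le_nvec: "x \<le> y \<Longrightarrow> y \<in> nvec k \<Longrightarrow> x \<in> nvec k"
  by (auto simp: nvec_def le_fun_def) (metis le_zero_eq)

lemma add_diff_inverse_fun: "(x :: nat \<Rightarrow> nat) \<le> y \<Longrightarrow> x + (y - x) = y"
  by (auto simp: le_fun_def fun_eq_iff)

definition nunit :: "nat \<Rightarrow> nat \<Rightarrow> nat" where
  "nunit i j = (if j = i then 1 else 0)"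

lemma nunit_in_nvec [simp]: "nunit i \<in> nvec k \<longleftrightarrow> i < k"
  by (auto simp: nvec_def nunit_def not_less)

lemma nunit_nonzero [simp]: "nunit i \<noteq> 0"
  by (metis nunit_def zero_fun_apply zero_neq_one)

text \<open>Forget the last coordinate and use the induction hypothesis. The basis F0 of the
  projections serves every vector whose last coordinate exceeds the bound m on those of F0. All
  others lie in the finitely many slices p k = j with j \<le> m, and each slice gets its own
  basis.\<close>

theorem dickson:
  assumes "P \<subseteq> nvec k"
  shows "\<exists>F\<subseteq>P. finite F \<and> (\<forall>p\<in>P. \<exists>f\<in>F. f \<le> p)"
  using assms
proof (induction k arbitrary: P)
  case 0
  have "finite P"
    by (rule finite_subset[OF 0]) simp
  then show ?case
    by (metis order_refl subset_refl)
next
  case (Suc k)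
  define t where "t x = x(k := 0)" for x :: "nat \<Rightarrow> nat"
  have sub: "\<exists>F\<subseteq>Q. finite F \<and> (\<forall>p\<in>Q. \<exists>f\<in>F. t f \<le> t p)" if "Q \<subseteq> P" for Q
  proof -
    have "t ` Q \<subseteq> nvec k"
      using that Suc.prems by (force simp: t_def nvec_def)
    then obtain F' where F': "F' \<subseteq> t ` Q" "finite F'" "\<forall>p\<in>t ` Q. \<exists>f\<in>F'. f \<le> p"
      using Suc.IH by metis
    then obtain F where "F \<subseteq> Q" "finite F" "F' = t ` F"
      by (meson finite_subset_image)
    moreover have "\<exists>f\<in>F. t f \<le> t p" if p: "p \<in> Q" for p
    proof -
      obtain f' where "f' \<in> F'" "f' \<le> t p"
        using F'(3) p by blast
      then show ?thesis
        using \<open>F' = t ` F\<close> by blast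
    qed
    ultimately show ?thesis
      by metis
  qed
  obtain F0 where F0: "F0 \<subseteq> P" "finite F0" "\<forall>p\<in>P. \<exists>f\<in>F0. t f \<le> t p"
    using sub[of P] by blast
  obtain m where m: "\<forall>f\<in>F0. f k \<le> m"
    using finite_nat_set_iff_bounded_le[of "(\<lambda>f. f k) ` F0"] F0(2) by auto
  have "\<exists>F\<subseteq>{p \<in> P. p k = j}. finite F \<and> (\<forall>p\<in>{p \<in> P. p k = j}. \<exists>f\<in>F. t f \<le> t p)" for j
    by (rule sub) auto
  then have "\<exists>F. \<forall>j. F j \<subseteq> {p \<in> P. p k = j} \<and> finite (F j)
      \<and> (\<forall>p\<in>{p \<in> P. p k = j}. \<exists>f\<in>F j. t f \<le> t p)"
    by (intro choice allI)
  then obtain F where F_all: "\<forall>j. F j \<subseteq> {p \<in> P. p k = j} \<and> finite (F j)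
      \<and> (\<forall>p\<in>{p \<in> P. p k = j}. \<exists>f\<in>F j. t f \<le> t p)"
    by (rule exE)
  have F: "F j \<subseteq> {p \<in> P. p k = j}" "finite (F j)"
      "\<forall>p\<in>{p \<in> P. p k = j}. \<exists>f\<in>F j. t f \<le> t p" for j
    using F_all[rule_format, of j] by simp_all
  have le: "f \<le> p" if "t f \<le> t p" "f k \<le> p k" for f p
    using that unfolding t_def le_fun_def by (metis fun_upd_other)
  show ?case
  proof (intro exI[of _ "F0 \<union> (\<Union>j\<le>m. F j)"] conjI ballI)
    show "F0 \<union> (\<Union>j\<le>m. F j) \<subseteq> P"
      using F0(1) F(1) by blast
    show "finite (F0 \<union> (\<Union>j\<le>m. F j))"
      using F0(2) F(2) by simp
    fix p assume "p \<in> P"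
    show "\<exists>f\<in>F0 \<union> (\<Union>j\<le>m. F j). f \<le> p"
    proof (cases "p k \<le> m")
      case True
      then obtain f where "f \<in> F (p k)" "t f \<le> t p"
        using F(3) \<open>p \<in> P\<close> by blast
      moreover from this have "f k = p k"
        using F(1) by blast
      ultimately show ?thesis
        using True le[of f p] by auto
    next
      case False
      obtain f where f: "f \<in> F0" "t f \<le> t p"
        using F0(3) \<open>p \<in> P\<close> by blast
      then have "f k \<le> p k"
        using m False by (meson le_trans linear)
      then show ?thesis
        using f le by blast
    qed
  qed
qed

section \<open>Counting exponent vectors by a positive additive weight\<close>

locale positive_weight =
  fixes k :: nat and d :: "(nat \<Rightarrow> nat) \<Rightarrow> int"
  assumes add: "x \<in> nvec k \<Longrightarrow> y \<in> nvec k \<Longrightarrow> d (x + y) = d x + d y"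
    and pos: "x \<in> nvec k \<Longrightarrow> x \<noteq> 0 \<Longrightarrow> 1 \<le> d x"
begin

lemma zero [simp]: "d 0 = 0"
  using add[of 0 0] by simp

lemma nonneg: "x \<in> nvec k \<Longrightarrow> 0 \<le> d x"
  using pos[of x] by (cases "x = 0") auto

lemma entry_le:
  assumes "x \<in> nvec k"
  shows "int (x i) \<le> d x"
  using assms
proof (induction "x i" arbitrary: x)
  case 0
  then show ?case
    by (metis nonneg of_nat_0)
next
  case (Suc n)
  then have i: "i < k"
    by (metis (mono_tags, lifting) leI mem_Collect_eq nat.distinct(1) nvec_def)
  have "x(i := n) \<in> nvec k"
    using Suc.prems i by (auto simp: nvec_def)
  moreover have "x(i := n) + nunit i = x"
    using Suc.hyps(2) by (auto simp: fun_eq_iff nunit_def)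
  ultimately have "d x = d (x(i := n)) + d (nunit i)" "int n \<le> d (x(i := n))"
    using add[of "x(i := n)" "nunit i"] Suc.hyps(1)[of "x(i := n)"] i by auto
  then show ?case
    using pos[of "nunit i"] i Suc.hyps(2) by simp
qed

lemma finite_bounded: "finite {x \<in> nvec k. d x \<le> int n}"
proof -
  have "x i \<le> n" if "x \<in> nvec k" "d x \<le> int n" for x i
    using entry_le[OF that(1), of i] that(2) by simp
  then have "{x \<in> nvec k. d x \<le> int n} \<subseteq> {x. \<forall>i. (i \<in> {..<k} \<longrightarrow> x i \<in> {..n}) \<and> (i \<notin> {..<k} \<longrightarrow> x i = 0)}"
    by (auto simp: nvec_def)
  then show ?thesis
    by (rule finite_subset) (rule finite_set_of_finite_funs; simp)
qed

lemma finite_fibre: "finite {x \<in> nvec k. d x = int n}"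
  by (rule finite_subset[OF _ finite_bounded[of n]]) auto

end

text \<open>Adding the last unit vector maps the larger set into itself, and what it misses is the
  set with one coordinate fewer. So each coordinate of weight w contributes a factor 1/(1 -
  z^w).\<close>

lemma rational_count_nvec:
  assumes "positive_weight k d"
  shows "rational_count d (nvec k)"
  using assms
proof (induction k)
  case 0
  interpret positive_weight 0 d by fact
  have "{x. x = 0 \<and> d x = int n} = (if n = 0 then {0} else {})" for n
    by (simp cong: conj_cong)
  then have "counting_series d {0} = fps_of_poly 1" "\<forall>n::nat. finite {x. x = 0 \<and> d x = int n}"
    by (auto simp: counting_series_def fps_eq_iff)
  then show ?case
    by (auto simp: rational_count_def simp del: fps_of_poly_1)
next
  case (Suc k)
  interpret positive_weight "Suc k" d by fact
  let ?y = "\<lambda>x. x + nunit k"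
  have "positive_weight k d"
    using nvec_mono[of k "Suc k"] by unfold_locales (simp_all add: add pos)
  then have IH: "rational_count d (nvec k)"
    by (rule Suc.IH)
  have "nvec (Suc k) - ?y ` nvec (Suc k) = nvec k"
  proof (intro equalityI subsetI)
    fix x assume x: "x \<in> nvec (Suc k) - ?y ` nvec (Suc k)"
    have "x k = 0"
    proof (rule ccontr)
      assume "x k \<noteq> 0"
      then have "x = ?y (x - nunit k)"
        by (auto simp: fun_eq_iff nunit_def)
      then show False
        using x by (metis DiffD1 DiffD2 diff_in_nvec image_eqI)
    qed
    then show "x \<in> nvec k"
      using x by (auto simp: nvec_def le_Suc_eq) (metis Suc_leI le_neq_implies_less)
  next
    fix x assume "x \<in> nvec k"
    then show "x \<in> nvec (Suc k) - ?y ` nvec (Suc k)"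
      by (auto simp: nvec_def nunit_def)
  qed
  then have "rational_count d (nvec (Suc k) - ?y ` nvec (Suc k))"
    using IH by simp
  then show ?case
  proof (rule rational_count_step[rotated -1])
    show "?y ` nvec (Suc k) \<subseteq> nvec (Suc k)" "inj_on ?y (nvec (Suc k))"
      by (auto simp: inj_on_def)
    show "d (x + nunit k) = d x + d (nunit k)" if "x \<in> nvec (Suc k)" for x
      using that by (simp add: add)
  qed (simp_all add: finite_fibre nonneg pos)
qed

text \<open>By Dickson's lemma U is a finite union of orthants. Orthants with corners a and b meet
  in the one with corner \<open>sup a b\<close>, and each is a translate of the whole of
  \<open>nvec k\<close>, so \<open>rational_count_UN\<close> applies.\<close>

lemma (in positive_weight) rational_count_upset:
  assumes "U \<subseteq> nvec k" and up: "\<And>u v. u \<in> U \<Longrightarrow> v \<in> nvec k \<Longrightarrow> u + v \<in> U"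
  shows "rational_count d U"
proof -
  let ?C = "(\<lambda>m. {x \<in> nvec k. m \<le> x}) ` nvec k"
  obtain F where F: "F \<subseteq> U" "finite F" "\<forall>p\<in>U. \<exists>f\<in>F. f \<le> p"
    using dickson[OF assms(1)] by metis
  have "U = (\<Union>m\<in>F. {x \<in> nvec k. m \<le> x})"
  proof (intro equalityI subsetI)
    fix x assume "x \<in> (\<Union>m\<in>F. {x \<in> nvec k. m \<le> x})"
    then obtain m where "m \<in> F" "m \<le> x" "x \<in> nvec k" by blast
    then show "x \<in> U"
      using up[of m "x - m"] F(1) by (auto simp: add_diff_inverse_fun)
  qed (use F assms(1) in blast)
  moreover have "rational_count d (\<Union>m\<in>F. {x \<in> nvec k. m \<le> x})"
  proof (rule rational_count_UN[of ?C])
    fix X Y assume "X \<in> ?C" "Y \<in> ?C"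
    then obtain a b where ab: "a \<in> nvec k" "b \<in> nvec k" "X = {x \<in> nvec k. a \<le> x}" "Y = {x \<in> nvec k. b \<le> x}"
      by blast
    have "sup a b \<in> nvec k"
      using ab(1,2) by (auto simp: nvec_def sup_nat_def)
    moreover have "X \<inter> Y = {x \<in> nvec k. sup a b \<le> x}"
      using ab by auto
    ultimately show "X \<inter> Y \<in> ?C" by blast
  next
    fix X assume "X \<in> ?C"
    then obtain m where m: "m \<in> nvec k" and X: "X = {x \<in> nvec k. m \<le> x}" by blast
    have "bij_betw (\<lambda>x. x + m) (nvec k) X"
    proof (rule bij_betw_byWitness[where f' = "\<lambda>x. x - m"])
      show "\<forall>x\<in>X. x - m + m = x"
        unfolding X using add_diff_inverse_fun by (metis (mono_tags, lifting) add.commute mem_Collect_eq)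
    qed (use m X in \<open>auto simp: le_fun_def\<close>)
    moreover have "rational_count (\<lambda>x. d x + d m) (nvec k)"
      using positive_weight_axioms m by (intro rational_count_shift rational_count_nvec nonneg)
    ultimately show "rational_count d X"
      using m by (auto intro: rational_count_bij add)
  qed (use F assms(1) in auto)
  ultimately show ?thesis
    by simp
qed

text \<open>\<open>less_fun\<close> compares at the first difference; its trichotomy needs functions
  that differ in finitely many places only, which \<open>nvec k\<close> guarantees.\<close>

lemma finite_lex_least:
  assumes "finite A" "A \<noteq> {}" "A \<subseteq> nvec k"
  shows "\<exists>l\<in>A. \<forall>x\<in>A. x \<noteq> l \<longrightarrow> less_fun l x"
proof (rule Finite_Set.bex_least_element[OF assms(1,2)])
  show "transp_on A less_fun"
    by (auto simp: transp_on_def intro: less_fun_trans)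
  have "finite {i. x i \<noteq> y i}" if "x \<in> A" "y \<in> A" for x y
  proof (rule finite_subset)
    have "x \<in> nvec k" "y \<in> nvec k"
      using that assms(3) by auto
    then show "{i. x i \<noteq> y i} \<subseteq> {..<k}"
      by (auto simp: nvec_def) (metis not_le)
  qed simp
  then show "totalp_on A less_fun"
    using less_fun_trichotomy unfolding totalp_on_def by blast
qed

text \<open>Translation invariance is what makes the vectors that are not least among those with the
  same value an up-closed set.\<close>

lemma less_fun_add [simp]:
  fixes x y z :: "nat \<Rightarrow> nat"
  shows "less_fun (x + z) (y + z) \<longleftrightarrow> less_fun x y"
  by (simp add: less_fun_def)

text \<open>Otherwise the simplifier turns the vectors in eta-expanded form that arise from resolution
  into lambda terms.\<close>

declare zero_fun_apply [simp del] plus_fun_apply [simp del]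

lemma nvec_induct [consumes 1, case_names zero add_unit]:
  assumes "x \<in> nvec k" "P 0"
    and step: "\<And>x i. x \<in> nvec k \<Longrightarrow> i < k \<Longrightarrow> P x \<Longrightarrow> P (x + nunit i)"
  shows "P x"
  using assms(1)
proof (induction "\<Sum>i<k. x i" arbitrary: x)
  case 0
  then have "x = 0"
    by (auto simp: nvec_def fun_eq_iff zero_fun_apply) (metis lessThan_iff not_le)
  then show ?case
    using assms(2) by metis
next
  case (Suc n)
  then obtain i where i: "i < k" "x i \<noteq> 0"
    by (metis lessThan_iff nat.distinct(1) sum.neutral)
  have pt: "(x - nunit i) j + nunit i j = x j" for j
    using i by (auto simp: nunit_def)
  then have x: "(x - nunit i) + nunit i = x"
    by (simp add: fun_eq_iff plus_fun_apply)
  have "(\<Sum>j<k. x j) = (\<Sum>j<k. (x - nunit i) j + nunit i j)"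
    by (rule sum.cong[OF refl]) (rule pt[symmetric])
  also have "\<dots> = (\<Sum>j<k. (x - nunit i) j) + (\<Sum>j<k. nunit i j)"
    by (rule sum.distrib)
  also have "(\<Sum>j<k. nunit i j) = 1"
    using i by (simp add: nunit_def)
  finally have "n = (\<Sum>j<k. (x - nunit i) j)"
    using Suc.hyps(2) by linarith
  then have "P (x - nunit i)"
    using Suc.hyps(1) Suc.prems diff_in_nvec by blast
  then have "P ((x - nunit i) + nunit i)"
    using i(1) Suc.prems by (intro step diff_in_nvec)
  then show ?case
    by (simp only: x)
qed

lemma positive_weightI:
  assumes add: "\<And>x y. x \<in> nvec k \<Longrightarrow> y \<in> nvec k \<Longrightarrow> d (x + y) = d x + d y"
    and "\<And>i. i < k \<Longrightarrow> 1 \<le> d (nunit i)"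
  shows "positive_weight k d"
proof
  have d0: "d 0 = 0"
    using add[of 0 0] by simp
  have *: "0 \<le> d x \<and> (x \<noteq> 0 \<longrightarrow> 1 \<le> d x)" if "x \<in> nvec k" for x
    using that
  proof (induction rule: nvec_induct)
    case zero
    then show ?case
      using d0 by (metis order_refl)
  next
    case (add_unit x i)
    then have "d (x + nunit i) = d x + d (nunit i)"
      by (simp add: add)
    then show ?case
      using add_unit assms(2)[of i] by linarith
  qed
  show "1 \<le> d x" if "x \<in> nvec k" "x \<noteq> 0" for x
    using * that by blast
qed (rule add)

section \<open>Finitely generated submonoids\<close>

inductive_set generated_submonoid :: "('a, 'b) monoid_scheme \<Rightarrow> 'a set \<Rightarrow> 'a set"
  for G (structure) and L where
  one: "\<one> \<in> generated_submonoid G L"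
| mult: "x \<in> L \<Longrightarrow> y \<in> generated_submonoid G L \<Longrightarrow> x \<otimes> y \<in> generated_submonoid G L"

definition nvec_hom :: "('a, 'b) monoid_scheme \<Rightarrow> nat \<Rightarrow> ((nat \<Rightarrow> nat) \<Rightarrow> 'a) \<Rightarrow> bool" where
  "nvec_hom G k f \<longleftrightarrow> (\<forall>x\<in>nvec k. f x \<in> carrier G)
     \<and> (\<forall>x\<in>nvec k. \<forall>y\<in>nvec k. f (x + y) = f x \<otimes>\<^bsub>G\<^esub> f y)"

lemma nvec_hom_closed: "nvec_hom G k f \<Longrightarrow> x \<in> nvec k \<Longrightarrow> f x \<in> carrier G"
  by (simp add: nvec_hom_def)

lemma nvec_hom_add:
  "nvec_hom G k f \<Longrightarrow> x \<in> nvec k \<Longrightarrow> y \<in> nvec k \<Longrightarrow> f (x + y) = f x \<otimes>\<^bsub>G\<^esub> f y"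
  by (simp add: nvec_hom_def)

lemma (in group) nvec_hom_zero:
  assumes "nvec_hom G k f"
  shows "f 0 = \<one>"
proof -
  have "f 0 \<in> carrier G"
    by (rule nvec_hom_closed[OF assms]) simp
  moreover have "f (0 + 0) = f 0 \<otimes> f 0"
    by (rule nvec_hom_add[OF assms]) simp_all
  ultimately show ?thesis
    by simp
qed

lemma (in monoid) generated_submonoid_closed:
  assumes "L \<subseteq> carrier G" "x \<in> generated_submonoid G L"
  shows "x \<in> carrier G"
  using assms(2) by (induction rule: generated_submonoid.induct) (use assms(1) in auto)

lemma (in monoid) generated_submonoid_mult:
  assumes "L \<subseteq> carrier G" "x \<in> generated_submonoid G L" "y \<in> generated_submonoid G L"
  shows "x \<otimes> y \<in> generated_submonoid G L"
  using assms(2)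
proof (induction rule: generated_submonoid.induct)
  case one
  then show ?case
    using assms generated_submonoid_closed by simp
next
  case (mult a b)
  then have "a \<otimes> b \<otimes> y = a \<otimes> (b \<otimes> y)"
    using assms generated_submonoid_closed by (intro m_assoc) auto
  then show ?case
    using mult by (simp add: generated_submonoid.mult)
qed

text \<open>Powers of commuting elements multiply exponentwise, so the free commutative monoid maps
  onto the submonoid, unit vectors going to generators. This carries Dickson's lemma and the
  lexicographic choice over to the group. The map may fail to be injective.\<close>

lemma (in comm_group) generated_submonoid_param:
  assumes "finite L" "L \<subseteq> carrier G"
  shows "\<exists>k f. nvec_hom G k f \<and> f ` nvec k = generated_submonoid G L \<and> (\<forall>i<k. f (nunit i) \<in> L)"
proof -
  obtain g where g: "bij_betw g {..<card L} L"
    using ex_bij_betw_nat_finite[OF assms(1)] atLeast0LessThan by metis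
  define k where "k = card L"
  have gL: "g i \<in> L" if "i < k" for i
    using g that by (auto simp: k_def bij_betw_def)
  have gc: "g i \<in> carrier G" if "i < k" for i
    using gL[OF that] assms(2) by blast
  define f where "f x = (\<Otimes>i\<in>{..<k}. g i [^] (x i :: nat))" for x
  have hom: "nvec_hom G k f"
    unfolding nvec_hom_def
  proof (intro conjI ballI)
    show "f x \<in> carrier G" for x
      unfolding f_def by (rule finprod_closed) (auto simp: gc)
    fix x y :: "nat \<Rightarrow> nat"
    have "f (x + y) = (\<Otimes>i\<in>{..<k}. g i [^] x i \<otimes> g i [^] y i)"
      unfolding f_def by (rule finprod_cong') (auto simp: gc nat_pow_mult plus_fun_apply)
    also have "\<dots> = f x \<otimes> f y"
      unfolding f_def by (rule finprod_multf) (auto simp: gc)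
    finally show "f (x + y) = f x \<otimes> f y" .
  qed
  have f_unit: "f (nunit i) = g i" if "i < k" for i
  proof -
    have "f (nunit i) = (\<Otimes>j\<in>{..<k}. if i = j then g j else \<one>)"
      unfolding f_def by (rule finprod_cong') (auto simp: gc nunit_def)
    also have "\<dots> = g i"
      by (rule finprod_singleton) (auto simp: gc that)
    finally show ?thesis .
  qed
  have f_add: "f (x + nunit i) = g i \<otimes> f x" if "x \<in> nvec k" "i < k" for x i
    using nvec_hom_add[OF hom, of "nunit i" x] that f_unit by (simp add: add.commute)
  have "f ` nvec k = generated_submonoid G L"
  proof (intro equalityI subsetI)
    fix a assume "a \<in> f ` nvec k"
    then obtain x where "x \<in> nvec k" "a = f x" by blast
    from this(1) have "f x \<in> generated_submonoid G L"
      by (induction rule: nvec_induct)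
        (auto simp: f_add gL nvec_hom_zero[OF hom] intro: generated_submonoid.intros)
    then show "a \<in> generated_submonoid G L"
      by (simp add: \<open>a = f x\<close>)
  next
    fix a assume "a \<in> generated_submonoid G L"
    then show "a \<in> f ` nvec k"
    proof (induction rule: generated_submonoid.induct)
      case one
      then show ?case
        using nvec_hom_zero[OF hom] by (metis imageI zero_in_nvec)
    next
      case (mult l b)
      obtain x where x: "x \<in> nvec k" "b = f x"
        using mult.IH by blast
      have "l \<in> g ` {..<k}"
        using g \<open>l \<in> L\<close> by (simp add: bij_betw_def k_def)
      then obtain i where i: "i < k" "l = g i"
        by blast
      then have "l \<otimes> b = f (x + nunit i)"
        using x f_add by simp
      then show ?case
        using x i by simp
    qed
  qed
  moreover have "\<forall>i<k. f (nunit i) \<in> L"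
    using f_unit gL by simp
  ultimately show ?thesis
    using hom by blast
qed

section \<open>Periodic sets\<close>

lemma mem_set_mult_image:
  "e \<in> C <#>\<^bsub>G\<^esub> f ` X \<longleftrightarrow> (\<exists>c\<in>C. \<exists>x\<in>X. e = c \<otimes>\<^bsub>G\<^esub> f x)"
  by (auto simp: set_mult_def)

locale graded_group = comm_group G for G (structure) +
  fixes deg :: "'a \<Rightarrow> int"
  assumes deg_mult: "x \<in> carrier G \<Longrightarrow> y \<in> carrier G \<Longrightarrow> deg (x \<otimes> y) = deg x + deg y"
begin

text \<open>All translates share one monoid. Any union of translates is then stable under it, which
  allows the translates to be counted one after the other.\<close>

definition periodic :: "'a set \<Rightarrow> bool" where
  "periodic E \<longleftrightarrow> (\<exists>C L. finite C \<and> C \<subseteq> carrier G \<and> (\<forall>c\<in>C. 0 \<le> deg c)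
     \<and> finite L \<and> L \<subseteq> carrier G \<and> (\<forall>l\<in>L. 1 \<le> deg l) \<and> E = C <#> generated_submonoid G L)"

lemma periodic_param:
  assumes "periodic E"
  obtains C k f where "finite C" "C \<subseteq> carrier G" "\<forall>c\<in>C. 0 \<le> deg c"
    "nvec_hom G k f" "positive_weight k (\<lambda>x. deg (f x))" "E = C <#> f ` nvec k"
proof -
  obtain C L where CL: "finite C" "C \<subseteq> carrier G" "\<forall>c\<in>C. 0 \<le> deg c"
      "finite L" "L \<subseteq> carrier G" "\<forall>l\<in>L. 1 \<le> deg l" "E = C <#> generated_submonoid G L"
    using assms unfolding periodic_def by metis
  obtain k f where f: "nvec_hom G k f" "f ` nvec k = generated_submonoid G L" "\<forall>i<k. f (nunit i) \<in> L"
    using generated_submonoid_param CL(4,5) by metis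
  have "positive_weight k (\<lambda>x. deg (f x))"
    using f(3) CL(6) by (intro positive_weightI)
      (auto simp: nvec_hom_add[OF f(1)] deg_mult nvec_hom_closed[OF f(1)])
  then show thesis
    using that CL f by metis
qed

lemma periodic_deg_nonneg:
  assumes "periodic E" "e \<in> E"
  shows "0 \<le> deg e"
proof -
  obtain C k f where *: "C \<subseteq> carrier G" "\<forall>c\<in>C. 0 \<le> deg c"
    "nvec_hom G k f" "positive_weight k (\<lambda>x. deg (f x))" "E = C <#> f ` nvec k"
    using periodic_param[OF assms(1)] by metis
  then obtain c x where "c \<in> C" "x \<in> nvec k" "e = c \<otimes> f x"
    using assms(2) by (auto simp: set_mult_def)
  then show ?thesis
    using * positive_weight.nonneg[OF *(4), of x] by (auto simp: deg_mult nvec_hom_closed)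
qed

text \<open>Counts what one more translate adds to a set U that is stable under the monoid. Each new
  element is represented by its lexicographically least exponent vector. The rejected vectors are
  up-closed: stability of U keeps c f(x + y) in U, and shifting by y preserves both f z = f x and
  the order of z and x.\<close>

lemma rational_count_translate_Diff:
  assumes hom: "nvec_hom G k f" and weight: "positive_weight k (\<lambda>x. deg (f x))"
    and c: "c \<in> carrier G" "0 \<le> deg c"
    and inv: "\<And>u x. u \<in> U \<Longrightarrow> x \<in> nvec k \<Longrightarrow> u \<otimes> f x \<in> U"
  shows "rational_count deg ((\<lambda>x. c \<otimes> f x) ` nvec k - U)"
proof -
  interpret positive_weight k "\<lambda>x. deg (f x)" by (rule weight)
  note closed = nvec_hom_closed[OF hom]
  define R where "R = {x \<in> nvec k. c \<otimes> f x \<notin> U \<and> (\<forall>y\<in>nvec k. f y = f x \<longrightarrow> \<not> less_fun y x)}"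
  have "rational_count (\<lambda>x. deg (f x)) (nvec k - R)"
  proof (rule rational_count_upset)
    fix x y assume xy: "x \<in> nvec k - R" "y \<in> nvec k"
    have eq: "c \<otimes> f (x + y) = c \<otimes> f x \<otimes> f y"
      using xy c closed by (simp add: nvec_hom_add[OF hom] m_assoc)
    consider "c \<otimes> f x \<in> U" | z where "z \<in> nvec k" "f z = f x" "less_fun z x"
      using xy(1) by (auto simp: R_def)
    then show "x + y \<in> nvec k - R"
    proof cases
      case 1
      then have "c \<otimes> f (x + y) \<in> U"
        using inv xy(2) eq by simp
      then show ?thesis
        using xy by (simp add: R_def)
    next
      case 2
      then have "f (z + y) = f (x + y)" "less_fun (z + y) (x + y)" "z + y \<in> nvec k"
        using xy by (simp_all add: nvec_hom_add[OF hom])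
      then show ?thesis
        using xy by (auto simp: R_def)
    qed
  qed auto
  then have "rational_count (\<lambda>x. deg (f x)) (nvec k - (nvec k - R))"
    by (rule rational_count_Diff[OF rational_count_nvec[OF weight]]) simp
  moreover have "nvec k - (nvec k - R) = R"
    by (auto simp: R_def)
  ultimately have "rational_count (\<lambda>x. deg (f x) + deg c) R"
    using c(2) nonneg by (intro rational_count_shift) (auto simp: R_def)
  moreover have "bij_betw (\<lambda>x. c \<otimes> f x) R ((\<lambda>x. c \<otimes> f x) ` nvec k - U)"
  proof (rule bij_betw_imageI)
    show "inj_on (\<lambda>x. c \<otimes> f x) R"
    proof (rule inj_onI)
      fix x y assume xy: "x \<in> R" "y \<in> R" and "c \<otimes> f x = c \<otimes> f y"
      then have "f x = f y"
        using c closed by (auto simp: R_def)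
      then have min: "\<not> less_fun x y" "\<not> less_fun y x"
        using xy by (auto simp: R_def)
      show "x = y"
        using finite_lex_least[of "{x, y}" k] xy min by (auto simp: R_def)
    qed
    show "(\<lambda>x. c \<otimes> f x) ` R = (\<lambda>x. c \<otimes> f x) ` nvec k - U"
    proof (intro equalityI subsetI)
      fix e assume "e \<in> (\<lambda>x. c \<otimes> f x) ` nvec k - U"
      then obtain x where x: "x \<in> nvec k" "e = c \<otimes> f x" "e \<notin> U" by blast
      \<comment> \<open>Equal values have equal degree, and only finitely many exponent vectors have
        a given degree, so a least one exists.\<close>
      let ?A = "{y \<in> nvec k. f y = f x}"
      have "finite ?A"
        using finite_fibre[of "nat (deg (f x))"] nonneg[OF x(1)] by (auto elim: finite_subset[rotated])
      then obtain l where l: "l \<in> ?A" "\<And>y. y \<in> ?A \<Longrightarrow> y \<noteq> l \<Longrightarrow> less_fun l y"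
        using finite_lex_least[of ?A k] x(1) by blast
      then have "l \<in> R"
        using x less_fun_asym less_fun_irrefl unfolding R_def by fastforce
      moreover have "e = c \<otimes> f l"
        using l(1) x(2) by simp
      ultimately show "e \<in> (\<lambda>x. c \<otimes> f x) ` R"
        by blast
    qed (auto simp: R_def)
  qed
  moreover have "deg (c \<otimes> f x) = deg (f x) + deg c" if "x \<in> R" for x
    using that c closed by (simp add: deg_mult R_def)
  ultimately show ?thesis
    by (rule rational_count_bij[rotated -1])
qed

theorem rational_count_periodic:
  assumes "periodic E"
  shows "rational_count deg E"
proof -
  obtain C k f where *: "finite C" "C \<subseteq> carrier G" "\<forall>c\<in>C. 0 \<le> deg c"
    and hom: "nvec_hom G k f" and weight: "positive_weight k (\<lambda>x. deg (f x))" and E: "E = C <#> f ` nvec k"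
    using periodic_param[OF assms] by metis
  have "rational_count deg (C <#> f ` nvec k)"
    using *
  proof (induction rule: finite_induct)
    case empty
    then show ?case
      by (simp add: set_mult_def)
  next
    case (insert c C)
    let ?U = "C <#> f ` nvec k"
    have "u \<otimes> f x \<in> ?U" if "u \<in> ?U" "x \<in> nvec k" for u x
    proof -
      obtain a y where a: "a \<in> C" "y \<in> nvec k" "u = a \<otimes> f y"
        using \<open>u \<in> ?U\<close> by (auto simp: set_mult_def)
      moreover have "a \<in> carrier G"
        using a(1) insert.prems by blast
      ultimately have "u \<otimes> f x = a \<otimes> f (y + x)"
        using that by (simp add: nvec_hom_add[OF hom] nvec_hom_closed[OF hom] m_assoc)
      then show ?thesis
        using a(1,2) \<open>x \<in> nvec k\<close> by (metis add_in_nvec mem_set_mult_image)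
    qed
    then have "rational_count deg ((\<lambda>x. c \<otimes> f x) ` nvec k - ?U)"
      using insert.prems by (intro rational_count_translate_Diff[OF hom weight]) auto
    then have "rational_count deg (?U \<union> ((\<lambda>x. c \<otimes> f x) ` nvec k - ?U))"
      using insert by (intro rational_count_Un_disjoint) auto
    moreover have "?U \<union> ((\<lambda>x. c \<otimes> f x) ` nvec k - ?U) = insert c C <#> f ` nvec k"
      by (auto simp: set_mult_def)
    ultimately show ?case
      by simp
  qed
  then show ?thesis
    by (simp add: E)
qed

text \<open>The common source of both closure properties below, in the manner of Gordan's lemma. If
  y \<le> x satisfy the same condition d j h(_) \<in> H, then x - y satisfies the homogeneous one,
  because H is a subgroup. So a Dickson basis of the nonzero homogeneous solutions generates the
  periods, and Dickson bases of the solutions for each j yield the translates. Positivity is asked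
  of homogeneous solutions only: in \<open>periodic_Int\<close> the map f ignores a block of
  coordinates and has degree 0 on it.\<close>

lemma periodic_solution_set:
  assumes f: "nvec_hom G k f" and h: "nvec_hom G k h" and H: "subgroup H G"
    and "finite J" and b: "\<And>j. j \<in> J \<Longrightarrow> b j \<in> carrier G" and d: "\<And>j. j \<in> J \<Longrightarrow> d j \<in> carrier G"
    and pos: "\<And>x. x \<in> nvec k \<Longrightarrow> h x \<in> H \<Longrightarrow> x \<noteq> 0 \<Longrightarrow> 1 \<le> deg (f x)"
    and E: "E = (\<Union>j\<in>J. {b j \<otimes> f x | x. x \<in> nvec k \<and> d j \<otimes> h x \<in> H})"
    and nonneg: "\<And>e. e \<in> E \<Longrightarrow> 0 \<le> deg e"
  shows "periodic E"
proof -
  interpret H: subgroup H G by (rule H)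
  note fc = nvec_hom_closed[OF f] and hc = nvec_hom_closed[OF h]
  have diff: "h (x - y) \<in> H"
    if "y \<le> x" "x \<in> nvec k" "a \<in> carrier G" "a \<otimes> h x \<in> H" "a \<otimes> h y \<in> H" for a x y
  proof -
    have y: "y \<in> nvec k"
      using that le_nvec by blast
    have "h x = h y \<otimes> h (x - y)"
      using nvec_hom_add[OF h y, of "x - y"] that by (simp add: add_diff_inverse_fun)
    then have "inv (a \<otimes> h y) \<otimes> (a \<otimes> h x) = h (x - y)"
      using that y hc by (simp add: m_assoc[symmetric] inv_mult_group) (simp add: m_assoc)
    then show ?thesis
      using that by (metis H.m_closed H.m_inv_closed)
  qed
  define P0 where "P0 = {x \<in> nvec k. h x \<in> H}"
  have P0_add: "x + y \<in> P0" if "x \<in> P0" "y \<in> P0" for x y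
    using that by (simp add: P0_def nvec_hom_add[OF h])
  have P0_diff: "x - y \<in> P0" if "x \<in> P0" "y \<in> P0" "y \<le> x" for x y
    using diff[of y x \<one>] that hc by (simp add: P0_def)
  obtain B where B: "B \<subseteq> P0 - {0}" "finite B" "\<forall>p\<in>P0 - {0}. \<exists>q\<in>B. q \<le> p"
    using dickson[of "P0 - {0}" k] unfolding P0_def by blast
  \<comment> \<open>Subtract a basis element below x and stay in P0. The coordinate sum drops
    because the basis avoids 0.\<close>
  have "f x \<in> generated_submonoid G (f ` B)" if "x \<in> P0" for x
    using that
  proof (induction "\<Sum>i<k. x i" arbitrary: x rule: less_induct)
    case less
    show ?case
    proof (cases "x = 0")
      case True
      then show ?thesis
        using nvec_hom_zero[OF f] by (metis generated_submonoid.one)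
    next
      case False
      then obtain q where q: "q \<in> B" "q \<le> x"
        using B(3) less.prems by blast
      then have qP: "q \<in> P0" "q \<noteq> 0" "q \<in> nvec k"
        using B(1) by (auto simp: P0_def)
      then obtain i where "i < k" "q i \<noteq> 0"
        unfolding nvec_def fun_eq_iff zero_fun_apply by (metis (mono_tags, lifting) mem_Collect_eq not_le)
      then have "i < k" "(x - q) i < x i"
        using le_funD[OF q(2), of i] by auto
      then have "(\<Sum>i<k. (x - q) i) < (\<Sum>i<k. x i)"
        by (intro sum_strict_mono_ex1) auto
      then have "f (x - q) \<in> generated_submonoid G (f ` B)"
        using less P0_diff q qP by blast
      then have "f q \<otimes> f (x - q) \<in> generated_submonoid G (f ` B)"
        using q by (intro generated_submonoid.mult) auto
      moreover have "f q \<otimes> f (x - q) = f x"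
        using nvec_hom_add[OF f qP(3), of "x - q"] less.prems q(2)
        by (simp add: add_diff_inverse_fun P0_def)
      ultimately show ?thesis
        by simp
    qed
  qed
  moreover have "\<exists>x\<in>P0. a = f x" if "a \<in> generated_submonoid G (f ` B)" for a
    using that
  proof (induction rule: generated_submonoid.induct)
    case one
    have "0 \<in> P0"
      using nvec_hom_zero[OF h] by (simp add: P0_def)
    then show ?case
      using nvec_hom_zero[OF f] by metis
  next
    case (mult l m)
    then obtain q x where "q \<in> P0" "l = f q" "x \<in> P0" "m = f x"
      using B(1) by blast
    then have "q + x \<in> P0" "l \<otimes> m = f (q + x)"
      using P0_add by (auto simp: P0_def nvec_hom_add[OF f])
    then show ?case
      by blast
  qed
  ultimately have gen: "generated_submonoid G (f ` B) = f ` P0"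
    by blast

  define P where "P j = {x \<in> nvec k. d j \<otimes> h x \<in> H}" for j
  have "\<forall>j. \<exists>F\<subseteq>P j. finite F \<and> (\<forall>p\<in>P j. \<exists>q\<in>F. q \<le> p)"
    using dickson[of "P _" k] by (auto simp: P_def)
  then have "\<exists>F. \<forall>j. F j \<subseteq> P j \<and> finite (F j) \<and> (\<forall>p\<in>P j. \<exists>q\<in>F j. q \<le> p)"
    by (rule choice)
  then obtain F where F_all: "\<forall>j. F j \<subseteq> P j \<and> finite (F j) \<and> (\<forall>p\<in>P j. \<exists>q\<in>F j. q \<le> p)"
    by (rule exE)
  have F: "F j \<subseteq> P j" "finite (F j)" "\<And>p. p \<in> P j \<Longrightarrow> \<exists>q\<in>F j. q \<le> p" for j
    using F_all[rule_format, of j] by auto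
  define C where "C = (\<Union>j\<in>J. (\<lambda>x. b j \<otimes> f x) ` F j)"
  have E': "e \<in> E \<longleftrightarrow> (\<exists>j\<in>J. \<exists>x\<in>P j. e = b j \<otimes> f x)" for e
    unfolding E P_def by blast
  have CE: "C \<subseteq> E"
    unfolding C_def using E' F(1) by blast
  have "E = C <#> f ` P0"
  proof (intro equalityI subsetI)
    fix e assume "e \<in> E"
    then obtain j x where jx: "j \<in> J" "x \<in> P j" "e = b j \<otimes> f x"
      using E' by blast
    then obtain q where q: "q \<in> F j" "q \<le> x"
      using F(3) by blast
    then have "q \<in> P j"
      using F(1) by blast
    then have "x - q \<in> P0"
      using diff[of q x "d j"] jx q d by (simp add: P_def P0_def)
    moreover have "e = (b j \<otimes> f q) \<otimes> f (x - q)"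
      using nvec_hom_add[OF f, of q "x - q"] jx q \<open>q \<in> P j\<close> b fc
      by (simp add: P_def add_diff_inverse_fun m_assoc)
    ultimately show "e \<in> C <#> f ` P0"
      using q jx(1) unfolding mem_set_mult_image C_def by blast
  next
    fix e assume "e \<in> C <#> f ` P0"
    then obtain j q x where jq: "j \<in> J" "q \<in> P j" "x \<in> P0" "e = (b j \<otimes> f q) \<otimes> f x"
      using F(1) unfolding mem_set_mult_image C_def by blast
    then have "e = b j \<otimes> f (q + x)"
      using b fc by (simp add: nvec_hom_add[OF f] P_def P0_def m_assoc)
    moreover have "d j \<otimes> h (q + x) = (d j \<otimes> h q) \<otimes> h x"
      using jq d hc by (simp add: nvec_hom_add[OF h] P_def P0_def m_assoc)
    then have "q + x \<in> P j"
      using jq by (simp add: P_def P0_def)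
    ultimately show "e \<in> E"
      using E' jq(1) by blast
  qed
  moreover have "E \<subseteq> carrier G"
    using E' b fc by (auto simp: P_def)
  moreover have "finite C"
    unfolding C_def using \<open>finite J\<close> F(2) by blast
  moreover have "1 \<le> deg (f q)" if "q \<in> B" for q
    using pos[of q] that B(1) by (auto simp: P0_def)
  ultimately show ?thesis
    unfolding periodic_def using CE B nonneg gen fc
    by (intro exI[of _ C] exI[of _ "f ` B"]) (auto simp: P0_def)
qed

text \<open>A common element c f(y) = c' f'(z) is a solution of the single equation (c c'^-1) (f(y)
  f'(z)^-1) = 1 in the concatenated exponent vector, whose halves are read off by l and r. So the
  subgroup is trivial here.\<close>

lemma periodic_Int:
  assumes "periodic E" "periodic E'"
  shows "periodic (E \<inter> E')"
proof -
  obtain C k f where C: "finite C" "C \<subseteq> carrier G"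
    and f: "nvec_hom G k f" and w: "positive_weight k (\<lambda>x. deg (f x))" and E: "E = C <#> f ` nvec k"
    using periodic_param[OF assms(1)] by metis
  obtain C' k' f' where C': "finite C'" "C' \<subseteq> carrier G"
    and f': "nvec_hom G k' f'" and w': "positive_weight k' (\<lambda>x. deg (f' x))" and E': "E' = C' <#> f' ` nvec k'"
    using periodic_param[OF assms(2)] by metis
  define l where "l x i = (if i < k then x i else 0)" for x :: "nat \<Rightarrow> nat" and i
  define r where "r x i = x (i + k)" for x :: "nat \<Rightarrow> nat" and i
  define join where "join y z i = (if i < k then y i else z (i - k))" for y z :: "nat \<Rightarrow> nat" and i
  have l: "l x \<in> nvec k" and l_add: "l (x + y) = l x + l y" for x y
    by (auto simp: l_def nvec_def fun_eq_iff plus_fun_apply)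
  have r: "x \<in> nvec (k + k') \<Longrightarrow> r x \<in> nvec k'" and r_add: "r (x + y) = r x + r y" for x y
    by (auto simp: r_def nvec_def fun_eq_iff plus_fun_apply)
  have join: "join y z \<in> nvec (k + k')" "l (join y z) = y" "r (join y z) = z"
    if "y \<in> nvec k" "z \<in> nvec k'" for y z
    using that by (auto simp: l_def r_def join_def nvec_def fun_eq_iff)
  have lr_zero: "x = 0" if "l x = 0" "r x = 0" for x
  proof
    fix i
    show "x i = 0 i"
      using fun_cong[OF that(1), of i] fun_cong[OF that(2), of "i - k"]
      by (simp add: l_def r_def zero_fun_apply split: if_splits)
  qed
  note fc = nvec_hom_closed[OF f] and fc' = nvec_hom_closed[OF f']
  have eq_iff: "c \<otimes> y = c' \<otimes> z \<longleftrightarrow> (c \<otimes> inv c') \<otimes> (y \<otimes> inv z) \<in> {\<one>}"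
    if "c \<in> carrier G" "c' \<in> carrier G" "y \<in> carrier G" "z \<in> carrier G" for c c' y z
  proof -
    have eq: "(c \<otimes> inv c') \<otimes> (y \<otimes> inv z) = (c \<otimes> y) \<otimes> inv (c' \<otimes> z)"
      using that by (simp add: inv_mult m_ac)
    have "(c \<otimes> y) \<otimes> inv (c' \<otimes> z) = \<one> \<longleftrightarrow> c \<otimes> y = \<one> \<otimes> (c' \<otimes> z)"
      using that by (intro inv_solve_right') auto
    then show ?thesis
      unfolding singleton_iff eq using that by simp
  qed
  show ?thesis
  proof (rule periodic_solution_set[where k = "k + k'" and f = "\<lambda>x. f (l x)"
      and h = "\<lambda>x. f (l x) \<otimes> inv (f' (r x))" and H = "{\<one>}" and J = "C \<times> C'"
      and b = fst and d = "\<lambda>(c, c'). c \<otimes> inv c'"])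
    show "nvec_hom G (k + k') (\<lambda>x. f (l x))"
      using l fc by (auto simp: nvec_hom_def l_add nvec_hom_add[OF f])
    show "nvec_hom G (k + k') (\<lambda>x. f (l x) \<otimes> inv (f' (r x)))"
      using l r fc fc'
      by (auto simp: nvec_hom_def l_add r_add nvec_hom_add[OF f] nvec_hom_add[OF f'] inv_mult m_ac)
    show "subgroup {\<one>} G"
      by (rule triv_subgroup)
    show "finite (C \<times> C')"
      using C C' by simp
    \<comment> \<open>The first half of a nonzero vector may vanish. Then the second half does not,
      and the equation transfers the positive degree of f'(r x) to f(l x).\<close>
    show "1 \<le> deg (f (l x))"
      if x: "x \<in> nvec (k + k')" and eq: "f (l x) \<otimes> inv (f' (r x)) \<in> {\<one>}" and "x \<noteq> 0" for x
    proof -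
      have "f (l x) = f' (r x)"
        using eq eq_iff[of \<one> \<one> "f (l x)" "f' (r x)"] l r[OF x] fc fc' by simp
      moreover have "l x \<noteq> 0 \<or> r x \<noteq> 0"
        using lr_zero \<open>x \<noteq> 0\<close> by blast
      ultimately show ?thesis
        using positive_weight.pos[OF w, of "l x"] positive_weight.pos[OF w', of "r x"] l r[OF x] by auto
    qed
    have "e \<in> E \<inter> E' \<longleftrightarrow> (\<exists>c\<in>C. \<exists>c'\<in>C'. \<exists>x\<in>nvec (k + k'). e = c \<otimes> f (l x) \<and> c \<otimes> f (l x) = c' \<otimes> f' (r x))" for e
    proof
      assume "e \<in> E \<inter> E'"
      then obtain c c' y z where *: "c \<in> C" "c' \<in> C'" "y \<in> nvec k" "z \<in> nvec k'" "e = c \<otimes> f y" "e = c' \<otimes> f' z"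
        unfolding E E' Int_iff mem_set_mult_image by blast
      then show "\<exists>c\<in>C. \<exists>c'\<in>C'. \<exists>x\<in>nvec (k + k'). e = c \<otimes> f (l x) \<and> c \<otimes> f (l x) = c' \<otimes> f' (r x)"
        using join[of y z] by metis
    next
      assume "\<exists>c\<in>C. \<exists>c'\<in>C'. \<exists>x\<in>nvec (k + k'). e = c \<otimes> f (l x) \<and> c \<otimes> f (l x) = c' \<otimes> f' (r x)"
      then show "e \<in> E \<inter> E'"
        unfolding E E' Int_iff mem_set_mult_image using l r by metis
    qed
    moreover have "(c \<otimes> f (l x) = c' \<otimes> f' (r x)) \<longleftrightarrow> (c \<otimes> inv c') \<otimes> (f (l x) \<otimes> inv (f' (r x))) \<in> {\<one>}"
      if "c \<in> C" "c' \<in> C'" "x \<in> nvec (k + k')" for c c' x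
      using that C C' fc[OF l] fc'[OF r] by (intro eq_iff) auto
    ultimately have mem: "e \<in> E \<inter> E' \<longleftrightarrow> (\<exists>c\<in>C. \<exists>c'\<in>C'. \<exists>x\<in>nvec (k + k'). e = c \<otimes> f (l x)
        \<and> (c \<otimes> inv c') \<otimes> (f (l x) \<otimes> inv (f' (r x))) \<in> {\<one>})" for e
      by (smt (verit, best))
    show "E \<inter> E' = (\<Union>j\<in>C \<times> C'. {fst j \<otimes> f (l x) | x. x \<in> nvec (k + k')
        \<and> (case j of (c, c') \<Rightarrow> c \<otimes> inv c') \<otimes> (f (l x) \<otimes> inv (f' (r x))) \<in> {\<one>}})" (is "_ = ?R")
    proof (intro Set.set_eqI iffI)
      fix e assume "e \<in> E \<inter> E'"
      then obtain c c' x where "c \<in> C" "c' \<in> C'" "x \<in> nvec (k + k')" "e = c \<otimes> f (l x)"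
          "(c \<otimes> inv c') \<otimes> (f (l x) \<otimes> inv (f' (r x))) \<in> {\<one>}"
        unfolding mem by blast
      then show "e \<in> ?R"
        by (intro UN_I[of "(c, c')"]) auto
    next
      fix e assume "e \<in> ?R"
      then obtain c c' x where "c \<in> C" "c' \<in> C'" "x \<in> nvec (k + k')" "e = c \<otimes> f (l x)"
          "(c \<otimes> inv c') \<otimes> (f (l x) \<otimes> inv (f' (r x))) \<in> {\<one>}"
        by auto
      then show "e \<in> E \<inter> E'"
        unfolding mem by blast
    qed
  qed (use C C' periodic_deg_nonneg[OF assms(1)] in auto)
qed

text \<open>By commutativity c f(x) lies in H a iff a^-1 c f(x) lies in H, so the condition is
  linear with f itself in the place of h.\<close>

lemma periodic_Int_rcoset:
  assumes "periodic E" "subgroup H G" "a \<in> carrier G"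
  shows "periodic (E \<inter> (H #> a))"
proof -
  interpret H: subgroup H G by fact
  obtain C k f where C: "finite C" "C \<subseteq> carrier G"
    and f: "nvec_hom G k f" and w: "positive_weight k (\<lambda>x. deg (f x))" and E: "E = C <#> f ` nvec k"
    using periodic_param[OF assms(1)] by metis
  note fc = nvec_hom_closed[OF f]
  show ?thesis
  proof (rule periodic_solution_set[OF f f assms(2) C(1), where b = "\<lambda>c. c" and d = "\<lambda>c. inv a \<otimes> c"])
    have "c \<otimes> f x \<in> H #> a \<longleftrightarrow> inv a \<otimes> c \<otimes> f x \<in> H" if "c \<in> C" "x \<in> nvec k" for c x
    proof -
      have "c \<in> carrier G" "f x \<in> carrier G"
        using that C fc by auto
      then have "inv a \<otimes> c \<otimes> f x = (c \<otimes> f x) \<otimes> inv a"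
        using assms(3) by (simp add: m_ac)
      then show ?thesis
        using \<open>c \<in> carrier G\<close> \<open>f x \<in> carrier G\<close> assms(3) by (simp add: H.rcos_module[OF group_axioms])
    qed
    then have "e \<in> E \<inter> (H #> a) \<longleftrightarrow> (\<exists>c\<in>C. \<exists>x\<in>nvec k. e = c \<otimes> f x \<and> inv a \<otimes> c \<otimes> f x \<in> H)" for e
      unfolding Int_iff E mem_set_mult_image by fast
    note mem = this
    show "E \<inter> (H #> a) = (\<Union>c\<in>C. {c \<otimes> f x | x. x \<in> nvec k \<and> inv a \<otimes> c \<otimes> f x \<in> H})"
      by (rule Set.set_eqI) (unfold mem UN_iff mem_Collect_eq, fast)
  qed (use C assms(3) periodic_deg_nonneg[OF assms(1)] positive_weight.pos[OF w] in auto)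
qed

theorem rational_count_UN_periodic:
  assumes "finite I" "\<And>i. i \<in> I \<Longrightarrow> periodic (E i)" "subgroup H G" "a \<in> carrier G"
  shows "rational_count deg ((\<Union>i\<in>I. E i) \<inter> (H #> a))"
proof -
  have "rational_count deg (\<Union>i\<in>I. E i \<inter> (H #> a))"
    using assms
    by (intro rational_count_UN[where \<C> = "Collect periodic"])
      (auto intro: periodic_Int rational_count_periodic periodic_Int_rcoset)
  moreover have "(\<Union>i\<in>I. E i) \<inter> (H #> a) = (\<Union>i\<in>I. E i \<inter> (H #> a))"
    by blast
  ultimately show ?thesis
    by (simp only:)
qed

end

section \<open>Words in a virtually abelian group\<close>

lemma (in group) rcoset_eq_iff:
  assumes "subgroup H G" "x \<in> carrier G" "y \<in> carrier G"
  shows "H #> x = H #> y \<longleftrightarrow> x \<otimes> inv y \<in> H"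
proof -
  have "H #> x = H #> y \<longleftrightarrow> x \<in> H #> y"
    using repr_independence[OF _ assms(3,1), of x] rcos_self[OF assms(2,1)] by auto
  then show ?thesis
    using subgroup.rcos_module[OF assms(1) group_axioms assms(3,2)] by simp
qed

lemma finite_image_if_determined:
  assumes "finite (r ` X)" "\<And>x y. x \<in> X \<Longrightarrow> y \<in> X \<Longrightarrow> r x = r y \<Longrightarrow> f x = f y"
  shows "finite (f ` X)"
proof (rule finite_subset)
  show "f ` X \<subseteq> (\<lambda>z. f (inv_into X r z)) ` r ` X"
  proof (intro image_subsetI)
    fix x assume "x \<in> X"
    then have "inv_into X r (r x) \<in> X" "r (inv_into X r (r x)) = r x"
      by (auto intro: inv_into_into f_inv_into_f)
    then have "f x = f (inv_into X r (r x))"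
      using assms(2) \<open>x \<in> X\<close> by metis
    then show "f x \<in> (\<lambda>z. f (inv_into X r z)) ` r ` X"
      using \<open>x \<in> X\<close> by blast
  qed
qed (use assms(1) in simp)

text \<open>The core A is the kernel of right multiplication on the right cosets of H: if g and g'
  move all cosets alike, then every conjugate of g g'^-1 lies in H. So the cosets of A inject into
  the self-maps of a finite set.\<close>

lemma (in group) normal_core_finite_index:
  assumes H: "subgroup H G" and fin: "finite (rcosets H)"
  shows "\<exists>A. A \<lhd> G \<and> A \<subseteq> H \<and> finite (rcosets A)"
proof -
  interpret H: subgroup H G by fact
  define A where "A = {g \<in> carrier G. \<forall>x\<in>carrier G. x \<otimes> g \<otimes> inv x \<in> H}"
  have sub: "subgroup A G"
  proof (rule subgroupI)
    show "A \<noteq> {}"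
      by (auto simp: A_def intro!: exI[of _ \<one>])
  next
    fix a assume a: "a \<in> A"
    have "x \<otimes> inv a \<otimes> inv x = inv (x \<otimes> a \<otimes> inv x)" if "x \<in> carrier G" for x
      using a that by (simp add: A_def inv_mult_group m_assoc)
    then show "inv a \<in> A"
      using a by (simp add: A_def)
  next
    fix a b assume ab: "a \<in> A" "b \<in> A"
    have "x \<otimes> (a \<otimes> b) \<otimes> inv x = (x \<otimes> a \<otimes> inv x) \<otimes> (x \<otimes> b \<otimes> inv x)" if "x \<in> carrier G" for x
      using ab that by (simp add: A_def m_assoc inv_solve_left)
    then show "a \<otimes> b \<in> A"
      using ab by (simp add: A_def)
  qed (auto simp: A_def)
  have "A \<lhd> G"
    unfolding normal_inv_iff
  proof (intro conjI ballI sub)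
    fix x a assume x: "x \<in> carrier G" "a \<in> A"
    have "y \<otimes> (x \<otimes> a \<otimes> inv x) \<otimes> inv y = (y \<otimes> x) \<otimes> a \<otimes> inv (y \<otimes> x)" if "y \<in> carrier G" for y
      using x that by (simp add: A_def inv_mult_group m_assoc)
    then show "x \<otimes> a \<otimes> inv x \<in> A"
      using x by (simp add: A_def)
  qed
  moreover have "A \<subseteq> H"
  proof
    fix g assume "g \<in> A"
    then have "\<one> \<otimes> g \<otimes> inv \<one> \<in> H" "g \<in> carrier G"
      unfolding A_def by blast+
    then show "g \<in> H"
      by simp
  qed
  moreover have "finite ((\<lambda>g. A #> g) ` carrier G)"
  proof (rule finite_image_if_determined[where r = "\<lambda>g. \<lambda>c\<in>rcosets H. c #> g"])
    show "finite ((\<lambda>g. \<lambda>c\<in>rcosets H. c #> g) ` carrier G)"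
    proof (rule finite_subset)
      show "(\<lambda>g. \<lambda>c\<in>rcosets H. c #> g) ` carrier G \<subseteq> (rcosets H) \<rightarrow>\<^sub>E (rcosets H)"
      proof (intro image_subsetI restrict_PiE_iff[THEN iffD2] ballI)
        fix g c assume "g \<in> carrier G" "c \<in> rcosets H"
        then obtain x where "x \<in> carrier G" "c = H #> x"
          unfolding RCOSETS_def by blast
        then show "c #> g \<in> rcosets H"
          using \<open>g \<in> carrier G\<close> H.subset by (simp add: coset_mult_assoc rcosetsI)
      qed
    qed (intro finite_PiE fin)
  next
    fix g g' assume g: "g \<in> carrier G" "g' \<in> carrier G"
      and eq: "(\<lambda>c\<in>rcosets H. c #> g) = (\<lambda>c\<in>rcosets H. c #> g')"
    have "x \<otimes> (g \<otimes> inv g') \<otimes> inv x \<in> H" if x: "x \<in> carrier G" for x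
    proof -
      have "H #> x \<in> rcosets H"
        using x by (rule rcosetsI[OF H.subset])
      then have "(H #> x) #> g = (H #> x) #> g'"
        using fun_cong[OF eq, of "H #> x"] by simp
      then have "(x \<otimes> g) \<otimes> inv (x \<otimes> g') \<in> H"
        using g x by (simp add: coset_mult_assoc H.subset rcoset_eq_iff[OF H])
      then show ?thesis
        using g x by (simp add: inv_mult_group m_assoc)
    qed
    then show "A #> g = A #> g'"
      using g by (simp add: rcoset_eq_iff[OF sub]) (simp add: A_def)
  qed
  then have "finite (rcosets A)"
    by (simp add: RCOSETS_def UNION_singleton_eq_range)
  ultimately show ?thesis
    by blast
qed

text \<open>T stands in for the quotient group, so that its elements can be used directly as
  conjugators; products are later brought back to T by \<open>rep\<close>.\<close>

locale abelian_transversal = normal A G for A and G (structure) +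
  fixes T :: "'a set"
  assumes A_comm: "x \<in> A \<Longrightarrow> y \<in> A \<Longrightarrow> x \<otimes> y = y \<otimes> x"
    and T_finite: "finite T" and T_subset: "T \<subseteq> carrier G"
    and T_rep: "g \<in> carrier G \<Longrightarrow> \<exists>!t. t \<in> T \<and> A #> t = A #> g"
begin

lemma A_subgroup: "subgroup A G"
  by (rule subgroup_axioms)

lemmas coset_eq_iff_A = rcoset_eq_iff[OF A_subgroup]

definition conj_by :: "'a \<Rightarrow> 'a \<Rightarrow> 'a" where
  "conj_by x g = x \<otimes> g \<otimes> inv x"

lemma conj_by_closed [simp]: "x \<in> carrier G \<Longrightarrow> g \<in> carrier G \<Longrightarrow> conj_by x g \<in> carrier G"
  by (simp add: conj_by_def)

lemma conj_by_in_A [simp]: "x \<in> carrier G \<Longrightarrow> a \<in> A \<Longrightarrow> conj_by x a \<in> A"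
  by (simp add: conj_by_def inv_op_closed2)

lemma conj_by_mult:
  "x \<in> carrier G \<Longrightarrow> g \<in> carrier G \<Longrightarrow> h \<in> carrier G \<Longrightarrow> conj_by x (g \<otimes> h) = conj_by x g \<otimes> conj_by x h"
  by (simp add: conj_by_def m_assoc inv_solve_left)

lemma conj_by_conj_by:
  "x \<in> carrier G \<Longrightarrow> y \<in> carrier G \<Longrightarrow> g \<in> carrier G \<Longrightarrow> conj_by x (conj_by y g) = conj_by (x \<otimes> y) g"
  by (simp add: conj_by_def inv_mult_group m_assoc)

lemma conj_by_one [simp]: "g \<in> carrier G \<Longrightarrow> conj_by \<one> g = g" "x \<in> carrier G \<Longrightarrow> conj_by x \<one> = \<one>"
  by (simp_all add: conj_by_def)

lemma conj_by_A: "a \<in> A \<Longrightarrow> b \<in> A \<Longrightarrow> conj_by a b = b"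
  using A_comm[of a b] by (simp add: conj_by_def m_assoc)

lemma conj_by_inv: "x \<in> carrier G \<Longrightarrow> g \<in> carrier G \<Longrightarrow> conj_by x (inv g) = inv (conj_by x g)"
  by (simp add: conj_by_def inv_mult_group m_assoc)

text \<open>Conjugation by an element of A is trivial on A, so a conjugate lying in A depends only
  on the coset of the conjugator. This is why a loop has the same effect wherever a word passes
  through its coset.\<close>

lemma conj_by_coset_eq:
  assumes "x \<in> carrier G" "y \<in> carrier G" "A #> x = A #> y" "g \<in> carrier G" "conj_by x g \<in> A"
  shows "conj_by y g = conj_by x g"
proof -
  have "y \<otimes> inv x \<in> A"
    using assms coset_eq_iff_A[of y x] by simp
  then have "conj_by (y \<otimes> inv x) (conj_by x g) = conj_by x g"
    using assms(5) by (rule conj_by_A)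
  then show ?thesis
    using assms by (simp add: conj_by_conj_by m_assoc)
qed

end

section \<open>Words as paths through the cosets of A\<close>

locale weighted_generators = abelian_transversal A G T for A and G (structure) and T +
  fixes S :: "'a set" and \<omega> :: "'a \<Rightarrow> nat"
  assumes S_finite: "finite S" and S_subset: "S \<subseteq> carrier G" and \<omega>_pos: "s \<in> S \<Longrightarrow> 1 \<le> \<omega> s"
begin

abbreviation "val \<equiv> word_value G"

abbreviation "wt \<equiv> word_weight \<omega>"

lemma val_Nil [simp]: "val [] = \<one>"
  by (simp add: word_value_def)

lemma val_closed [simp]: "w \<in> lists S \<Longrightarrow> val w \<in> carrier G"
  using S_subset by (induction w) (auto simp: word_value_def)

lemma val_append [simp]: "u \<in> lists S \<Longrightarrow> v \<in> lists S \<Longrightarrow> val (u @ v) = val u \<otimes> val v"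
proof (induction u)
  case Nil
  then show ?case
    using val_closed[of v] by (simp add: word_value_def)
next
  case (Cons s w)
  then have "s \<in> carrier G" "w \<in> lists S"
    using S_subset by auto
  then show ?case
    using Cons val_closed[of w] val_closed[of v] by (simp add: word_value_def m_assoc)
qed

lemma wt_append [simp]: "wt (u @ v) = wt u + wt v"
  by (simp add: word_weight_def)

lemma wt_pos: "w \<in> lists S \<Longrightarrow> w \<noteq> [] \<Longrightarrow> 1 \<le> wt w"
  using \<omega>_pos by (cases w) (auto simp: word_weight_def Suc_le_eq)

text \<open>The vertices of the path that a word describes in the Cayley graph of the quotient, both
  ends included.\<close>

definition visits_from :: "'a set \<Rightarrow> 'a list \<Rightarrow> 'a set set" where
  "visits_from c w = {c #> val p | p q. w = p @ q}"

definition visits :: "'a list \<Rightarrow> 'a set set" where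
  "visits w = visits_from A w"

lemma visits_append:
  assumes "p \<in> lists S" "q \<in> lists S"
  shows "visits (p @ q) = visits p \<union> visits_from (A #> val p) q"
proof -
  have *: "A #> val (p @ r) = A #> val p #> val r" if "q = r @ s" for r s
  proof -
    have "r \<in> lists S"
      using assms(2) that by simp
    then show ?thesis
      using assms(1) by (simp add: coset_mult_assoc subset)
  qed
  have "x \<in> visits (p @ q) \<longleftrightarrow> x \<in> visits p \<or> x \<in> visits_from (A #> val p) q" for x
  proof
    assume "x \<in> visits (p @ q)"
    then obtain u v where uv: "p @ q = u @ v" "x = A #> val u"
      by (auto simp: visits_def visits_from_def)
    from uv(1) consider r where "p = u @ r" | r where "u = p @ r" "q = r @ v"
      by (auto simp: append_eq_append_conv2)
    then show "x \<in> visits p \<or> x \<in> visits_from (A #> val p) q"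
      using uv(2) * by cases (auto simp: visits_def visits_from_def)
  next
    assume "x \<in> visits p \<or> x \<in> visits_from (A #> val p) q"
    then show "x \<in> visits (p @ q)"
    proof
      assume "x \<in> visits p"
      then show ?thesis
        unfolding visits_def visits_from_def by auto
    next
      assume "x \<in> visits_from (A #> val p) q"
      then obtain r s where "q = r @ s" "x = A #> val (p @ r)"
        using * unfolding visits_from_def by auto
      then show ?thesis
        unfolding visits_def visits_from_def by (intro CollectI exI[of _ "p @ r"] exI[of _ s]) simp
    qed
  qed
  then show ?thesis
    by blast
qed

lemma visits_subset: "w \<in> lists S \<Longrightarrow> visits w \<subseteq> rcosets A"
proof
  fix c assume "w \<in> lists S" "c \<in> visits w"
  then obtain p q where "c = A #> val p" "w = p @ q"
    unfolding visits_def visits_from_def by blast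
  moreover from this have "p \<in> lists S"
    using \<open>w \<in> lists S\<close> by simp
  ultimately show "c \<in> rcosets A"
    using subset by (simp add: rcosetsI del: in_lists_conv_set)
qed

lemma end_in_visits: "A #> val w \<in> visits w"
  unfolding visits_def visits_from_def by blast

text \<open>The number of pairs (current coset, set of cosets visited so far). The prefixes of
  length 0 up to this number are one too many to have distinct pairs.\<close>

definition loop_bound :: nat where
  "loop_bound = card ((rcosets A) \<times> Pow (rcosets A))"

text \<open>The element \<open>(\<one>, 1)\<close> is slack: it turns words of weight at most \<open>n\<close> into elements of degree
  exactly \<open>n\<close>.\<close>

definition loops :: "'a set set \<Rightarrow> ('a \<times> int) set" where
  "loops V = insert (\<one>, 1) {(conj_by p (val l), int (wt l)) | p l. p \<in> carrier G \<and> A #> p \<in> V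
     \<and> l \<in> lists S \<and> l \<noteq> [] \<and> length l \<le> loop_bound \<and> conj_by p (val l) \<in> A}"

lemma rcosets_A_finite: "finite (rcosets A)"
proof (rule finite_subset)
  show "rcosets A \<subseteq> (\<lambda>t. A #> t) ` T"
  proof
    fix c assume "c \<in> rcosets A"
    then obtain g where g: "g \<in> carrier G" "c = A #> g"
      unfolding RCOSETS_def by blast
    then obtain t where "t \<in> T" "A #> t = A #> g"
      using T_rep[OF g(1)] by blast
    then show "c \<in> (\<lambda>t. A #> t) ` T"
      using g(2) by blast
  qed
qed (simp add: T_finite)

text \<open>The base point p may range over infinitely many elements, but the conjugate depends only
  on its coset, so p can be taken from T.\<close>

lemma loops_finite: "finite (loops V)"
proof -
  have "loops V \<subseteq> insert (\<one>, 1)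
      ((\<lambda>(t, l). (conj_by t (val l), int (wt l))) ` (T \<times> {l. set l \<subseteq> S \<and> length l \<le> loop_bound}))"
  proof
    fix x assume "x \<in> loops V"
    then consider "x = (\<one>, 1)" | p l where "x = (conj_by p (val l), int (wt l))" "p \<in> carrier G"
        "l \<in> lists S" "length l \<le> loop_bound" "conj_by p (val l) \<in> A"
      unfolding loops_def by blast
    then show "x \<in> insert (\<one>, 1)
      ((\<lambda>(t, l). (conj_by t (val l), int (wt l))) ` (T \<times> {l. set l \<subseteq> S \<and> length l \<le> loop_bound}))"
    proof cases
      case 2
      obtain t where t: "t \<in> T" "A #> t = A #> p"
        using T_rep[OF 2(2)] by blast
      then have "conj_by t (val l) = conj_by p (val l)"
        using 2 T_subset by (intro conj_by_coset_eq) auto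
      then show ?thesis
        using 2 t by (intro insertI2 image_eqI[of _ _ "(t, l)"]) auto
    qed simp
  qed
  then show ?thesis
    by (rule finite_subset) (simp add: T_finite S_finite finite_lists_length_le)
qed

lemma loops_subset: "loops V \<subseteq> A \<times> {1..}"
proof
  fix x assume "x \<in> loops V"
  then consider "x = (\<one>, 1)" | p l where "x = (conj_by p (val l), int (wt l))" "l \<in> lists S" "l \<noteq> []"
      "conj_by p (val l) \<in> A"
    unfolding loops_def by blast
  then show "x \<in> A \<times> {1..}"
    using wt_pos by cases (force simp del: in_lists_conv_set)+
qed

abbreviation "loop_monoid V \<equiv> generated_submonoid (G \<times>\<times> integer_group) (loops V)"

lemma loop_monoid_subset: "x \<in> loop_monoid V \<Longrightarrow> x \<in> A \<times> {0..}"
proof (induction rule: generated_submonoid.induct)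
  case (mult l m)
  moreover have "l \<in> A \<times> {1..}"
    using mult.hyps loops_subset by blast
  ultimately show ?case
    by (auto simp: mult_DirProd')
qed auto

lemma loop_monoid_slack: "(\<one>, int n) \<in> loop_monoid V"
proof (induction n)
  case 0
  then show ?case
    using generated_submonoid.one[of "G \<times>\<times> integer_group"] by simp
next
  case (Suc n)
  have "(\<one>, 1) \<otimes>\<^bsub>G \<times>\<times> integer_group\<^esub> (\<one>, int n) \<in> loop_monoid V"
    using Suc by (intro generated_submonoid.mult) (simp add: loops_def)
  then show ?case
    by (simp add: add.commute)
qed

lemma loop_iff:
  assumes "p \<in> lists S" "l \<in> lists S"
  shows "A #> val (p @ l) = A #> val p \<longleftrightarrow> conj_by (val p) (val l) \<in> A"
  using assms by (simp add: coset_eq_iff_A conj_by_def)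

text \<open>A repeated coset alone would already give a loop. Repeating the visited set as well
  ensures that l meets no coset that p has missed, so cutting l out leaves the visited set of the
  whole word unchanged.\<close>

lemma word_reduce:
  assumes "w \<in> lists S" "length w > loop_bound"
  obtains p l q where "w = p @ l @ q" "l \<noteq> []" "length l \<le> loop_bound"
    "A #> val (p @ l) = A #> val p" "visits (p @ l) = visits p"
proof -
  define s where "s i = (A #> val (take i w), visits (take i w))" for i
  have tk: "take i w \<in> lists S" for i
    using assms(1) by (auto dest: in_set_takeD)
  have "s ` {..loop_bound} \<subseteq> (rcosets A) \<times> Pow (rcosets A)"
    using tk visits_subset subset by (auto simp: s_def intro!: rcosetsI) blast
  then have "card (s ` {..loop_bound}) \<le> loop_bound"
    unfolding loop_bound_def by (intro card_mono) (auto simp: rcosets_A_finite)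
  then have "\<not> inj_on s {..loop_bound}"
    by (intro pigeonhole) simp
  then obtain i j where ij: "i < j" "j \<le> loop_bound" "s i = s j"
    unfolding inj_on_def by (metis atMost_iff linorder_neqE_nat)
  define l where "l = take (j - i) (drop i w)"
  have j: "take j w = take i w @ l"
    using ij(1) take_add[of i "j - i" w] by (simp add: l_def)
  show thesis
  proof (rule that)
    have "w = take j w @ drop j w"
      by simp
    then show "w = take i w @ l @ drop j w"
      unfolding j by simp
    show "l \<noteq> []"
      using ij assms(2) by (simp add: l_def)
    show "length l \<le> loop_bound"
      using ij by (simp add: l_def)
    show "A #> val (take i w @ l) = A #> val (take i w)" "visits (take i w @ l) = visits (take i w)"
      using ij(3) unfolding s_def j by simp_all
  qed
qed

text \<open>Since p l q = (p l p^-1) p q, each cut moves a loop to the front as an element of A. The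
  visited set is the same after every cut, so all loops collected come from the one set
  \<open>loops (visits w)\<close>.\<close>

lemma word_decompose:
  assumes "w \<in> lists S"
  shows "\<exists>u\<in>lists S. length u \<le> loop_bound \<and> visits u = visits w
    \<and> (\<exists>a m. (a, m) \<in> loop_monoid (visits w) \<and> val w = a \<otimes> val u \<and> int (wt w) = m + int (wt u))"
  using assms
proof (induction "length w" arbitrary: w rule: less_induct)
  case less
  show ?case
  proof (cases "length w \<le> loop_bound")
    case True
    then show ?thesis
      using loop_monoid_slack[of 0] less.prems by (intro bexI[of _ w] conjI exI[of _ \<one>] exI[of _ 0]) auto
  next
    case False
    then obtain p l q where w: "w = p @ l @ q" and l: "l \<noteq> []" "length l \<le> loop_bound"
      and loop: "A #> val (p @ l) = A #> val p" and vis: "visits (p @ l) = visits p"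
      using word_reduce less.prems by (metis not_le)
    have S: "p \<in> lists S" "l \<in> lists S" "q \<in> lists S"
      using less.prems w by auto
    have v: "visits w = visits (p @ q)"
      using visits_append[of "p @ l" q] visits_append[of p q] S loop vis w by simp
    obtain u a m where u: "u \<in> lists S" "length u \<le> loop_bound" "visits u = visits w"
      and am: "(a, m) \<in> loop_monoid (visits w)" "val (p @ q) = a \<otimes> val u" "int (wt (p @ q)) = m + int (wt u)"
      using less.hyps[of "p @ q"] l(1) S w v by auto
    define b where "b = conj_by (val p) (val l)"
    have "b \<in> A"
      using loop loop_iff[OF S(1,2)] by (simp add: b_def)
    moreover have "A #> val p \<in> visits w"
      unfolding v using visits_append[OF S(1,3)] end_in_visits by blast
    ultimately have "(b, int (wt l)) \<in> loops (visits w)"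
      unfolding loops_def b_def using l S val_closed[OF S(1)] by blast
    then have "(b, int (wt l)) \<otimes>\<^bsub>G \<times>\<times> integer_group\<^esub> (a, m) \<in> loop_monoid (visits w)"
      using am(1) by (intro generated_submonoid.mult)
    moreover have "val w = (b \<otimes> a) \<otimes> val u"
    proof -
      have "val w = b \<otimes> val (p @ q)"
        using val_closed[OF S(1)] val_closed[OF S(2)] val_closed[OF S(3)] S w
        by (simp add: b_def conj_by_def m_assoc inv_solve_left del: in_lists_conv_set)
      also have "\<dots> = (b \<otimes> a) \<otimes> val u"
        using am u \<open>b \<in> A\<close> loop_monoid_subset[OF am(1)] by (simp add: m_assoc)
      finally show ?thesis .
    qed
    ultimately show ?thesis
      using u am w by (intro bexI[of _ u] conjI exI[of _ "b \<otimes> a"] exI[of _ "int (wt l) + m"]) auto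
  qed
qed

text \<open>Loops are put back one by one: if r ends in the coset of the loop l, then r s becomes r
  l s. Visited cosets are only gained, so the remaining loops still find their place. The slack
  generator adds no letter, whence a mere inequality of weights.\<close>

lemma word_compose:
  assumes "x \<in> loop_monoid (visits u)" "u \<in> lists S"
  shows "\<exists>w\<in>lists S. visits u \<subseteq> visits w \<and> val w = fst x \<otimes> val u \<and> int (wt w) \<le> snd x + int (wt u)"
  using assms(1)
proof (induction rule: generated_submonoid.induct)
  case one
  then show ?case
    using assms(2) by (intro bexI[of _ u]) auto
next
  case (mult x y)
  then obtain w where w: "w \<in> lists S" "visits u \<subseteq> visits w" "val w = fst y \<otimes> val u"
      "int (wt w) \<le> snd y + int (wt u)"
    by blast
  have y: "fst y \<in> carrier G"
    using loop_monoid_subset[OF mult.hyps(2)] by auto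
  from mult.hyps(1) consider "x = (\<one>, 1)"
    | p l where "x = (conj_by p (val l), int (wt l))" "p \<in> carrier G" "A #> p \<in> visits u"
        "l \<in> lists S" "conj_by p (val l) \<in> A"
    unfolding loops_def by blast
  then show ?case
  proof cases
    case 1
    then show ?thesis
      using w y by (intro bexI[of _ w]) (auto simp: mult_DirProd')
  next
    case 2
    have "A #> p \<in> visits w"
      using 2(3) w(2) by blast
    then obtain r s where rs: "w = r @ s" "A #> p = A #> val r"
      unfolding visits_def visits_from_def by blast
    then have S: "r \<in> lists S" "s \<in> lists S"
      using w(1) by auto
    have conj: "conj_by (val r) (val l) = conj_by p (val l)"
      using 2 rs S by (intro conj_by_coset_eq) auto
    then have loop: "A #> val (r @ l) = A #> val r"
      using loop_iff[OF S(1) 2(4)] 2(5) by simp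
    have "visits w \<subseteq> visits (r @ l @ s)"
      using visits_append[OF S] visits_append[of "r @ l" s] visits_append[OF S(1) 2(4)] S 2(4) loop rs
      by auto
    moreover have "val (r @ l @ s) = conj_by (val r) (val l) \<otimes> val w"
      using S 2(4) rs val_closed[OF S(1)] val_closed[OF S(2)] val_closed[OF 2(4)]
      by (simp add: conj_by_def m_assoc inv_solve_left del: in_lists_conv_set)
    then have "val (r @ l @ s) = (conj_by p (val l) \<otimes> fst y) \<otimes> val u"
      using w(3) 2 y assms(2) conj by (simp add: m_assoc)
    ultimately show ?thesis
      using w 2 S rs by (intro bexI[of _ "r @ l @ s"]) (auto simp: mult_DirProd')
  qed
qed

theorem word_value_weight_iff:
  assumes "g \<in> carrier G"
  shows "(\<exists>w\<in>lists S. val w = g \<and> wt w \<le> n) \<longleftrightarrow>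
    (\<exists>u\<in>lists S. length u \<le> loop_bound
      \<and> (\<exists>a m. (a, m) \<in> loop_monoid (visits u) \<and> g = a \<otimes> val u \<and> int n = m + int (wt u)))"
    (is "?L \<longleftrightarrow> ?R")
proof
  assume ?L
  then obtain w where w: "w \<in> lists S" "val w = g" "wt w \<le> n" by blast
  then obtain u a m where u: "u \<in> lists S" "length u \<le> loop_bound" "visits u = visits w"
    and am: "(a, m) \<in> loop_monoid (visits w)" "val w = a \<otimes> val u" "int (wt w) = m + int (wt u)"
    using word_decompose by blast
  \<comment> \<open>Slack fills the gap between the weight of w and n.\<close>
  have "(\<one>, int (n - wt w)) \<otimes>\<^bsub>G \<times>\<times> integer_group\<^esub> (a, m) \<in> loop_monoid (visits w)"
  proof -
    have "loops (visits w) \<subseteq> carrier (G \<times>\<times> integer_group)"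
      using loops_subset subset by auto
    moreover have "Group.monoid (G \<times>\<times> integer_group)"
      by (simp add: DirProd_group group.is_monoid)
    ultimately show ?thesis
      using loop_monoid_slack am(1) by (intro monoid.generated_submonoid_mult)
  qed
  moreover have "a \<in> carrier G"
    using loop_monoid_subset[OF am(1)] by auto
  ultimately have "(a, int (n - wt w) + m) \<in> loop_monoid (visits u)"
    using u(3) by simp
  then show ?R
    using u am w by (intro bexI[of _ u] conjI exI[of _ a] exI[of _ "int (n - wt w) + m"]) auto
next
  assume ?R
  then show ?L
    using word_compose by fastforce
qed

end

section \<open>Counting orbits\<close>

text \<open>Burnside's lemma for a transversal instead of a group. T need not be closed under
  products, so it is only required that precomposing with act s permutes the maps act t, by a
  permutation \<sigma> of the indices.\<close>

lemma orbit_counting: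
  assumes "finite T" "finite X" and e: "e \<in> T" "\<And>y. y \<in> X \<Longrightarrow> act e y = y"
    and act: "\<And>t y. t \<in> T \<Longrightarrow> y \<in> X \<Longrightarrow> act t y \<in> X"
    and comp: "\<And>s. s \<in> T \<Longrightarrow> \<exists>\<sigma>. bij_betw \<sigma> T T \<and> (\<forall>t\<in>T. \<forall>y\<in>X. act (\<sigma> t) y = act t (act s y))"
  shows "(\<Sum>t\<in>T. card {y \<in> X. act t y = y}) = card T * card ((\<lambda>y. (\<lambda>t. act t y) ` T) ` X)"
proof -
  define orb where "orb y = (\<lambda>t. act t y) ` T" for y
  have refl: "y \<in> orb y" if "y \<in> X" for y
    using e that unfolding orb_def by force
  have orbX: "orb y \<subseteq> X" if "y \<in> X" for y
    using act that by (auto simp: orb_def)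
  have trans: "orb z = orb y" and card_stab: "card {t \<in> T. act t z = z} = card {t \<in> T. act t y = z}"
    if y: "y \<in> X" and z: "z \<in> orb y" for y z
  proof -
    obtain s where s: "s \<in> T" "z = act s y"
      using z by (auto simp: orb_def)
    obtain \<sigma> where \<sigma>: "bij_betw \<sigma> T T" "\<And>t. t \<in> T \<Longrightarrow> act (\<sigma> t) y = act t z"
      using comp[OF s(1)] y s(2) by blast
    have im: "\<sigma> ` T = T"
      using \<sigma>(1) by (rule bij_betw_imp_surj_on)
    have "orb z = (\<lambda>t. act (\<sigma> t) y) ` T"
      unfolding orb_def using \<sigma>(2) by (intro image_cong) auto
    also have "\<dots> = (\<lambda>t. act t y) ` \<sigma> ` T"
      by (simp only: image_image)
    finally show "orb z = orb y"
      by (simp only: im orb_def)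
    have "bij_betw \<sigma> {t \<in> T. act t z = z} {t \<in> T. act t y = z}"
      unfolding bij_betw_def
    proof
      show "inj_on \<sigma> {t \<in> T. act t z = z}"
        using \<sigma>(1) by (auto simp: bij_betw_def inj_on_def)
      show "\<sigma> ` {t \<in> T. act t z = z} = {t \<in> T. act t y = z}"
      proof (intro equalityI subsetI)
        fix t' assume "t' \<in> \<sigma> ` {t \<in> T. act t z = z}"
        then obtain t where "t \<in> T" "act t z = z" "t' = \<sigma> t"
          by blast
        then show "t' \<in> {t \<in> T. act t y = z}"
          using im \<sigma>(2)[of t] by auto
      next
        fix t' assume "t' \<in> {t \<in> T. act t y = z}"
        then obtain t where "t \<in> T" "t' = \<sigma> t" "act t' y = z"
          using im by blast
        then show "t' \<in> \<sigma> ` {t \<in> T. act t z = z}"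
          using \<sigma>(2)[of t] by auto
      qed
    qed
    then show "card {t \<in> T. act t z = z} = card {t \<in> T. act t y = z}"
      by (rule bij_betw_same_card)
  qed
  have "(\<Sum>t\<in>T. card {y \<in> X. act t y = y}) = (\<Sum>y\<in>X. card {t \<in> T. act t y = y})"
    using assms(1,2) by (intro sum_multicount_gen) auto
  also have "\<dots> = (\<Sum>o'\<in>orb ` X. \<Sum>y\<in>{y \<in> X. orb y = o'}. card {t \<in> T. act t y = y})"
    by (rule sum.image_gen[OF assms(2)])
  also have "\<dots> = (\<Sum>o'\<in>orb ` X. card T)"
  proof (rule sum.cong[OF HOL.refl])
    fix o' assume "o' \<in> orb ` X"
    then obtain y where y: "y \<in> X" "o' = orb y" by blast
    have "{z \<in> X. orb z = o'} = orb y"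
      using y refl trans orbX by blast
    \<comment> \<open>By \<open>card_stab\<close> the stabiliser of a point z in the orbit of y is
      as large as the set of t with act t y = z, and these sets partition T.\<close>
    then have "(\<Sum>z\<in>{z \<in> X. orb z = o'}. card {t \<in> T. act t z = z}) = (\<Sum>z\<in>orb y. card {t \<in> T. act t y = z})"
      using card_stab[OF y(1)] by (intro sum.cong) auto
    also have "\<dots> = (\<Sum>z\<in>orb y. \<Sum>t\<in>{t \<in> T. act t y = z}. 1)"
      by simp
    also have "\<dots> = (\<Sum>t\<in>T. 1)"
      unfolding orb_def by (rule sum.image_gen[symmetric, OF assms(1)])
    finally show "(\<Sum>z\<in>{z \<in> X. orb z = o'}. card {t \<in> T. act t z = z}) = card T"
      by simp
  qed
  finally show ?thesis
    by (simp add: orb_def)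
qed

section \<open>The action of G/A on A-classes\<close>

context abelian_transversal begin

definition a_class :: "'a \<Rightarrow> 'a set" where
  "a_class g = (\<lambda>a. conj_by a g) ` A"

lemma a_class_self: "g \<in> carrier G \<Longrightarrow> g \<in> a_class g"
  unfolding a_class_def by (rule image_eqI[of _ _ \<one>]) auto

lemma a_class_conj_by_A:
  assumes "a \<in> A" "g \<in> carrier G"
  shows "a_class (conj_by a g) = a_class g"
proof (intro equalityI subsetI)
  fix x assume "x \<in> a_class (conj_by a g)"
  then obtain b where "b \<in> A" "x = conj_by (b \<otimes> a) g"
    using assms by (auto simp: a_class_def conj_by_conj_by)
  then show "x \<in> a_class g"
    using assms unfolding a_class_def by blast
next
  fix x assume "x \<in> a_class g"
  then obtain b where b: "b \<in> A" "x = conj_by b g"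
    by (auto simp: a_class_def)
  then have "x = conj_by (b \<otimes> inv a) (conj_by a g)"
    using assms by (simp add: conj_by_conj_by m_assoc)
  then show "x \<in> a_class (conj_by a g)"
    using assms b unfolding a_class_def by blast
qed

lemma a_class_eqI: "h \<in> a_class g \<Longrightarrow> g \<in> carrier G \<Longrightarrow> a_class h = a_class g"
proof -
  assume "h \<in> a_class g" and g: "g \<in> carrier G"
  then obtain a where "a \<in> A" "h = conj_by a g"
    unfolding a_class_def by (elim imageE)
  then show ?thesis
    using g by (simp add: a_class_conj_by_A)
qed

lemma conj_by_a_class:
  assumes "x \<in> carrier G" "g \<in> carrier G"
  shows "conj_by x ` a_class g = a_class (conj_by x g)"
proof (intro equalityI subsetI)
  fix y assume "y \<in> conj_by x ` a_class g"
  then obtain a where "a \<in> A" "y = conj_by x (conj_by a g)"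
    by (auto simp: a_class_def)
  moreover have "conj_by x a \<otimes> x = x \<otimes> a"
    using assms \<open>a \<in> A\<close> by (simp add: conj_by_def m_assoc)
  ultimately have "y = conj_by (conj_by x a) (conj_by x g)"
    using assms by (simp add: conj_by_conj_by)
  moreover have "conj_by x a \<in> A"
    using assms \<open>a \<in> A\<close> by simp
  ultimately show "y \<in> a_class (conj_by x g)"
    unfolding a_class_def by (rule image_eqI)
next
  fix y assume "y \<in> a_class (conj_by x g)"
  then obtain a where a: "a \<in> A" "y = conj_by a (conj_by x g)"
    by (auto simp: a_class_def)
  have "x \<otimes> conj_by (inv x) a = a \<otimes> x"
    using assms a(1) by (simp add: conj_by_def m_assoc[symmetric])
  then have "y = conj_by x (conj_by (conj_by (inv x) a) g)"
    using assms a by (simp add: conj_by_conj_by)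
  moreover have "conj_by (conj_by (inv x) a) g \<in> a_class g"
    using assms a(1) unfolding a_class_def by simp
  ultimately show "y \<in> conj_by x ` a_class g"
    by (rule image_eqI)
qed

text \<open>The two conjugators differ by an element of A, which does not change the A-class. So G
  acts on A-classes through G/A.\<close>

lemma a_class_conj_by_coset:
  assumes "x \<in> carrier G" "y \<in> carrier G" "A #> x = A #> y" "g \<in> carrier G"
  shows "a_class (conj_by x g) = a_class (conj_by y g)"
proof -
  have "x \<otimes> inv y \<in> A"
    using assms coset_eq_iff_A by blast
  moreover have "conj_by x g = conj_by (x \<otimes> inv y) (conj_by y g)"
    using assms by (simp add: conj_by_conj_by m_assoc)
  ultimately show ?thesis
    using assms a_class_conj_by_A by simp
qed

definition rep :: "'a \<Rightarrow> 'a" where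
  "rep g = (THE t. t \<in> T \<and> A #> t = A #> g)"

lemma rep: "g \<in> carrier G \<Longrightarrow> rep g \<in> T" "g \<in> carrier G \<Longrightarrow> A #> rep g = A #> g"
  using theI'[OF T_rep[of g]] unfolding rep_def by auto

lemma T_carrier: "t \<in> T \<Longrightarrow> t \<in> carrier G"
  using T_subset by blast

lemma T_eqI:
  assumes "s \<in> T" "t \<in> T" "A #> s = A #> t"
  shows "s = t"
proof (rule ex1E[OF T_rep[OF T_carrier[OF assms(2)]]])
  fix u assume u: "\<forall>v. v \<in> T \<and> A #> v = A #> t \<longrightarrow> v = u"
  have "s = u"
    using spec[OF u, of s] assms(1,3) by blast
  moreover have "t = u"
    using spec[OF u, of t] assms(2) by blast
  ultimately show "s = t"
    by simp
qed

definition conj_class :: "'a \<Rightarrow> 'a set" where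
  "conj_class g = (\<lambda>x. conj_by x g) ` carrier G"

lemma conj_class_self: "g \<in> carrier G \<Longrightarrow> g \<in> conj_class g"
  unfolding conj_class_def by (rule image_eqI[of _ _ \<one>]) auto

lemma conj_class_subset: "g \<in> carrier G \<Longrightarrow> conj_class g \<subseteq> carrier G"
  by (auto simp: conj_class_def)

lemma conj_class_eqI:
  assumes "h \<in> conj_class g" "g \<in> carrier G"
  shows "conj_class h = conj_class g"
proof -
  obtain y where y: "y \<in> carrier G" "h = conj_by y g"
    using assms by (auto simp: conj_class_def)
  show ?thesis
  proof (intro equalityI subsetI)
    fix z assume "z \<in> conj_class h"
    then obtain x where "x \<in> carrier G" "z = conj_by (x \<otimes> y) g"
      using y assms(2) by (auto simp: conj_class_def conj_by_conj_by)
    then show "z \<in> conj_class g"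
      using y unfolding conj_class_def by blast
  next
    fix z assume "z \<in> conj_class g"
    then obtain x where x: "x \<in> carrier G" "z = conj_by x g"
      by (auto simp: conj_class_def)
    then have "z = conj_by (x \<otimes> inv y) h"
      using y assms(2) by (simp add: conj_by_conj_by m_assoc)
    then show "z \<in> conj_class h"
      using x y unfolding conj_class_def by blast
  qed
qed

text \<open>Identifies an orbit of A-classes with the set of A-classes inside one conjugacy class; T
  suffices as set of conjugators because the action factors through G/A.\<close>

lemma a_classes_of_conj_class:
  assumes "g \<in> carrier G"
  shows "(\<lambda>t. conj_by t ` a_class g) ` T = a_class ` conj_class g"
proof (intro equalityI subsetI)
  fix y assume "y \<in> (\<lambda>t. conj_by t ` a_class g) ` T"
  then show "y \<in> a_class ` conj_class g"
    using assms T_carrier conj_by_a_class unfolding conj_class_def by blast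
next
  fix y assume "y \<in> a_class ` conj_class g"
  then obtain x where x: "x \<in> carrier G" "y = a_class (conj_by x g)"
    by (auto simp: conj_class_def)
  then have "y = a_class (conj_by (rep x) g)"
    using rep[OF x(1)] T_carrier assms by (simp add: a_class_conj_by_coset[of "rep x" x])
  then show "y \<in> (\<lambda>t. conj_by t ` a_class g) ` T"
    using rep[OF x(1)] T_carrier assms conj_by_a_class by blast
qed

lemma Union_a_classes:
  assumes "g \<in> carrier G"
  shows "\<Union> (a_class ` conj_class g) = conj_class g"
proof (intro equalityI subsetI)
  fix x assume "x \<in> \<Union> (a_class ` conj_class g)"
  then obtain h a where "h \<in> conj_class g" "a \<in> A" "x = conj_by a h"
    by (auto simp: a_class_def)
  then show "x \<in> conj_class g"
    using conj_class_eqI[OF _ assms, of h] by (auto simp: conj_class_def)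
next
  fix x assume "x \<in> conj_class g"
  then show "x \<in> \<Union> (a_class ` conj_class g)"
    using conj_class_subset[OF assms] a_class_self by blast
qed

text \<open>Burnside for the A-classes in a conjugation-stable set Z. The union of an orbit of
  A-classes is the conjugacy class it comes from, so orbits and conjugacy classes are equal in
  number.\<close>

theorem card_conj_classes:
  assumes "Z \<subseteq> carrier G" and conj: "\<And>x g. x \<in> carrier G \<Longrightarrow> g \<in> Z \<Longrightarrow> conj_by x g \<in> Z"
    and fin: "finite (a_class ` Z)"
  shows "(\<Sum>t\<in>T. card {y \<in> a_class ` Z. conj_by t ` y = y}) = card T * card (conj_class ` Z)"
proof -
  have one: "conj_by (rep \<one>) ` a_class g = a_class g" if "g \<in> carrier G" for g
    using that rep[of \<one>] T_carrier a_class_conj_by_coset[of "rep \<one>" \<one> g] by (simp add: conj_by_a_class)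
  have "(\<Sum>t\<in>T. card {y \<in> a_class ` Z. conj_by t ` y = y})
      = card T * card ((\<lambda>y. (\<lambda>t. conj_by t ` y) ` T) ` a_class ` Z)"
  proof (rule orbit_counting[OF T_finite fin, of "rep \<one>"])
    show "rep \<one> \<in> T"
      by (simp add: rep)
    show "conj_by (rep \<one>) ` y = y" if "y \<in> a_class ` Z" for y
      using that one assms(1) by blast
    show "conj_by t ` y \<in> a_class ` Z" if "t \<in> T" "y \<in> a_class ` Z" for t y
    proof -
      obtain g where "g \<in> Z" "y = a_class g"
        using \<open>y \<in> a_class ` Z\<close> by blast
      then show ?thesis
        using conj_by_a_class[of t g] conj[of t g] T_carrier[OF \<open>t \<in> T\<close>] assms(1) by blast
    qed
    fix s assume s: "s \<in> T"
    \<comment> \<open>Right multiplication by s in G/A, brought back to T.\<close>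
    let ?\<sigma> = "\<lambda>t. rep (t \<otimes> s)"
    have "inj_on ?\<sigma> T"
    proof (rule inj_onI)
      fix t t' assume t: "t \<in> T" "t' \<in> T" "rep (t \<otimes> s) = rep (t' \<otimes> s)"
      then have "A #> (t \<otimes> s) = A #> (t' \<otimes> s)"
        using rep(2)[of "t \<otimes> s"] rep(2)[of "t' \<otimes> s"] s T_carrier by simp
      then have "(t \<otimes> s) \<otimes> inv (t' \<otimes> s) \<in> A"
        using t s T_carrier by (simp add: coset_eq_iff_A)
      moreover have "(t \<otimes> s) \<otimes> inv (t' \<otimes> s) = t \<otimes> inv t'"
      proof -
        have c: "t \<in> carrier G" "t' \<in> carrier G" "s \<in> carrier G"
          using t s T_carrier by auto
        then have "s \<otimes> (inv s \<otimes> inv t') = inv t'"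
          by (simp add: m_assoc[symmetric])
        then show ?thesis
          using c by (simp add: inv_mult_group m_assoc)
      qed
      ultimately have "t \<otimes> inv t' \<in> A"
        using t s T_carrier by simp
      then show "t = t'"
        using t T_carrier by (intro T_eqI) (simp_all add: coset_eq_iff_A)
    qed
    moreover have "?\<sigma> ` T \<subseteq> T"
      using rep s T_carrier by auto
    ultimately have "bij_betw ?\<sigma> T T"
      using endo_inj_surj[OF T_finite] by (simp add: bij_betw_def)
    moreover have "conj_by (?\<sigma> t) ` y = conj_by t ` conj_by s ` y" if t: "t \<in> T" and "y \<in> a_class ` Z" for t y
    proof -
      obtain g where g: "g \<in> carrier G" "y = a_class g"
        using \<open>y \<in> a_class ` Z\<close> assms(1) by blast
      have "a_class (conj_by (?\<sigma> t) g) = a_class (conj_by (t \<otimes> s) g)"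
        using g t s T_carrier rep[of "t \<otimes> s"] by (intro a_class_conj_by_coset) auto
      then show ?thesis
        using g t s T_carrier rep[of "t \<otimes> s"] by (simp add: conj_by_a_class conj_by_conj_by)
    qed
    ultimately show "\<exists>\<sigma>. bij_betw \<sigma> T T
        \<and> (\<forall>t\<in>T. \<forall>y\<in>a_class ` Z. conj_by (\<sigma> t) ` y = conj_by t ` conj_by s ` y)"
      by (intro exI[of _ ?\<sigma>]) blast
  qed
  also have "(\<lambda>y. (\<lambda>t. conj_by t ` y) ` T) ` a_class ` Z = (\<lambda>c. a_class ` c) ` conj_class ` Z"
    unfolding image_image
    by (rule image_cong[OF refl], rule a_classes_of_conj_class) (use assms(1) in blast)
  also have "card \<dots> = card (conj_class ` Z)"
  proof (intro card_image inj_onI)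
    have Union: "\<Union> (a_class ` c) = c" if "c \<in> conj_class ` Z" for c
    proof -
      obtain g where "g \<in> Z" "c = conj_class g"
        using \<open>c \<in> conj_class ` Z\<close> by (rule imageE)
      then show ?thesis
        using Union_a_classes[of g] assms(1) by auto
    qed
    fix c c' assume c: "c \<in> conj_class ` Z" "c' \<in> conj_class ` Z" and eq: "a_class ` c = a_class ` c'"
    have "c = \<Union> (a_class ` c)"
      using c(1) by (rule Union[symmetric])
    also have "\<dots> = \<Union> (a_class ` c')"
      by (simp only: eq)
    also have "\<dots> = c'"
      using c(2) by (rule Union)
    finally show "c = c'" .
  qed
  finally show ?thesis .
qed

end

section \<open>Conjugacy classes as cosets\<close>

text \<open>Multiplicativity is assumed only for a generator times an element of the monoid, because
  \<open>push\<close> will be known to be multiplicative only on pairs with first component in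
  A.\<close>

lemma generated_submonoid_image:
  assumes "h \<one>\<^bsub>G\<^esub> = \<one>\<^bsub>H\<^esub>"
    and "\<And>x y. x \<in> L \<Longrightarrow> y \<in> generated_submonoid G L \<Longrightarrow> h (x \<otimes>\<^bsub>G\<^esub> y) = h x \<otimes>\<^bsub>H\<^esub> h y"
  shows "generated_submonoid H (h ` L) = h ` generated_submonoid G L"
proof (intro equalityI subsetI)
  fix z assume "z \<in> generated_submonoid H (h ` L)"
  then show "z \<in> h ` generated_submonoid G L"
  proof (induction rule: generated_submonoid.induct)
    case one
    then show ?case
      using assms(1) generated_submonoid.one[of G L] by (metis imageI)
  next
    case (mult a b)
    then obtain x y where "x \<in> L" "a = h x" "y \<in> generated_submonoid G L" "b = h y"
      by blast
    then show ?case
      using assms(2)[of x y] generated_submonoid.mult[of x L y G] by (metis imageI)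
  qed
next
  fix z assume "z \<in> h ` generated_submonoid G L"
  then obtain x where x: "x \<in> generated_submonoid G L" "z = h x"
    by blast
  from x(1) have "h x \<in> generated_submonoid H (h ` L)"
  proof (induction rule: generated_submonoid.induct)
    case one
    then show ?case
      by (simp add: assms(1) generated_submonoid.one)
  next
    case (mult a b)
    then show ?case
      by (simp add: assms(2) generated_submonoid.mult)
  qed
  then show "z \<in> generated_submonoid H (h ` L)"
    by (simp add: x(2))
qed

context abelian_transversal begin

lemma A_carrier: "a \<in> A \<Longrightarrow> a \<in> carrier G"
  using subset by blast

lemma A_lcomm: "x \<in> A \<Longrightarrow> y \<in> A \<Longrightarrow> z \<in> carrier G \<Longrightarrow> x \<otimes> (y \<otimes> z) = y \<otimes> (x \<otimes> z)"
  using A_comm[of x y] by (simp add: m_assoc[symmetric] A_carrier)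

abbreviation "GA \<equiv> G\<lparr>carrier := A\<rparr>"

lemma GA_comm_group: "comm_group GA"
proof (rule group.group_comm_groupI)
  show "Group.group GA"
    by (rule subgroup_is_group) (rule group_axioms)
qed (simp add: A_comm)

text \<open>The \<open>A\<close>-class of \<open>a b\<close> is the coset of \<open>a b\<close> with respect to this subgroup of \<open>A\<close>.\<close>

definition displacement :: "'a \<Rightarrow> 'a set" where
  "displacement b = (\<lambda>x. x \<otimes> inv (conj_by b x)) ` A"

lemma displacement_subset: "b \<in> carrier G \<Longrightarrow> displacement b \<subseteq> A"
  by (auto simp: displacement_def)

text \<open>As A is commutative, sending x to x (b x b^-1)^-1 is an endomorphism of A, and this is
  its image.\<close>

lemma displacement_subgroup:
  assumes b: "b \<in> carrier G"
  shows "subgroup (displacement b) GA"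
proof -
  interpret GA: comm_group GA by (rule GA_comm_group)
  have "(\<lambda>x. x \<otimes> inv (conj_by b x)) \<in> hom GA GA"
  proof (rule homI)
    fix x y assume "x \<in> carrier GA" "y \<in> carrier GA"
    then have xy: "x \<in> A" "y \<in> A" by simp_all
    have "x \<otimes> y \<otimes> inv (conj_by b (x \<otimes> y)) = x \<otimes> (y \<otimes> (inv (conj_by b y) \<otimes> inv (conj_by b x)))"
      using xy b by (simp add: conj_by_mult inv_mult_group m_assoc A_carrier)
    also have "\<dots> = x \<otimes> (inv (conj_by b x) \<otimes> (y \<otimes> inv (conj_by b y)))"
      using xy b A_comm[of "y \<otimes> inv (conj_by b y)" "inv (conj_by b x)"] by (simp add: m_assoc A_carrier)
    finally show "x \<otimes>\<^bsub>GA\<^esub> y \<otimes> inv (conj_by b (x \<otimes>\<^bsub>GA\<^esub> y))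
        = (x \<otimes> inv (conj_by b x)) \<otimes>\<^bsub>GA\<^esub> (y \<otimes> inv (conj_by b y))"
      using xy b by (simp add: m_assoc A_carrier)
  qed (use b in simp)
  then have "group_hom GA GA (\<lambda>x. x \<otimes> inv (conj_by b x))"
    by (intro group_hom.intro group_hom_axioms.intro GA.group_axioms)
  from group_hom.img_is_subgroup[OF this] show ?thesis
    by (simp add: displacement_def)
qed

lemma displacement_subgroup_G: "b \<in> carrier G \<Longrightarrow> subgroup (displacement b) G"
  using incl_subgroup[OF A_subgroup displacement_subgroup] .

text \<open>For x in A, x a b x^-1 = x a (b x^-1 b^-1) b, and the bracket lies in A, so it may be
  moved in front of a.\<close>

lemma a_class_eq_coset:
  assumes a: "a \<in> A" and b: "b \<in> carrier G"
  shows "a_class (a \<otimes> b) = displacement b #> (a \<otimes> b)"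
proof -
  have "conj_by x (a \<otimes> b) = (x \<otimes> inv (conj_by b x)) \<otimes> (a \<otimes> b)" if x: "x \<in> A" for x
  proof -
    have "inv (conj_by b x) \<otimes> (a \<otimes> b) = a \<otimes> (inv (conj_by b x) \<otimes> b)"
      using x a b by (intro A_lcomm) auto
    also have "inv (conj_by b x) \<otimes> b = b \<otimes> inv x"
      using x b by (simp add: conj_by_def inv_mult_group m_assoc A_carrier)
    finally show ?thesis
      using x a b by (simp add: conj_by_def m_assoc A_carrier)
  qed
  then show ?thesis
    unfolding a_class_def displacement_def r_coset_def by (auto simp: image_def)
qed

text \<open>Translated by b, this coset becomes the A-class of a b; so the quotient
  \<open>Q b\<close> enumerates the A-classes inside A b.\<close>

definition dcoset :: "'a \<Rightarrow> 'a \<Rightarrow> 'a set" where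
  "dcoset b a = displacement b #> a"

lemma dcoset_rcoset:
  assumes "a \<in> A" "b \<in> carrier G"
  shows "dcoset b a #> b = a_class (a \<otimes> b)"
  unfolding dcoset_def a_class_eq_coset[OF assms]
  using assms A_carrier subgroup.subset[OF displacement_subgroup_G[OF assms(2)]]
  by (intro coset_mult_assoc) auto

lemma dcoset_eq_iff:
  assumes "a \<in> A" "a' \<in> A" "b \<in> carrier G"
  shows "dcoset b a = dcoset b a' \<longleftrightarrow> a \<otimes> inv a' \<in> displacement b"
  unfolding dcoset_def using assms by (intro rcoset_eq_iff displacement_subgroup_G) (simp_all add: A_carrier)

lemma a_class_eq_iff:
  assumes "a \<in> A" "a' \<in> A" "b \<in> carrier G"
  shows "a_class (a \<otimes> b) = a_class (a' \<otimes> b) \<longleftrightarrow> dcoset b a = dcoset b a'"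
proof -
  have "b \<otimes> (inv b \<otimes> inv a') = inv a'"
    using assms A_carrier by (simp add: m_assoc[symmetric])
  then have "a \<otimes> b \<otimes> inv (a' \<otimes> b) = a \<otimes> inv a'"
    using assms A_carrier by (simp add: inv_mult_group m_assoc)
  then show ?thesis
    unfolding a_class_eq_coset[OF assms(1,3)] a_class_eq_coset[OF assms(2,3)] dcoset_eq_iff[OF assms]
    using assms A_carrier by (subst rcoset_eq_iff) (auto simp: displacement_subgroup_G)
qed

section \<open>The graded quotient group attached to a coset of A\<close>

abbreviation "Q b \<equiv> GA Mod displacement b"

lemma carrier_Q: "carrier (Q b) = dcoset b ` A"
  by (simp add: carrier_FactGroup dcoset_def r_coset_def)

lemma dcoset_mult:
  assumes "b \<in> carrier G" "a \<in> A" "a' \<in> A"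
  shows "dcoset b a \<otimes>\<^bsub>Q b\<^esub> dcoset b a' = dcoset b (a \<otimes> a')"
proof -
  have "displacement b \<lhd> GA"
    using comm_group.normal_iff_subgroup[OF GA_comm_group] displacement_subgroup assms(1) by simp
  from normal.rcos_sum[OF this, of a a'] show ?thesis
    using assms by (simp add: dcoset_def r_coset_def)
qed

lemma dcoset_hom: "b \<in> carrier G \<Longrightarrow> dcoset b \<in> hom GA (Q b)"
  by (rule homI) (simp_all add: carrier_Q dcoset_mult del: mult_FactGroup)

lemma dcoset_one:
  assumes "b \<in> carrier G"
  shows "dcoset b \<one> = \<one>\<^bsub>Q b\<^esub>"
  using displacement_subset[OF assms] subset by (simp add: dcoset_def)

abbreviation "\<Gamma> b \<equiv> Q b \<times>\<times> integer_group"

lemma Q_comm_group: "b \<in> carrier G \<Longrightarrow> comm_group (Q b)"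
  by (intro comm_group.abelian_FactGroup GA_comm_group displacement_subgroup)

lemma \<Gamma>_graded_group:
  assumes "b \<in> carrier G"
  shows "graded_group (\<Gamma> b) snd"
proof -
  interpret Q: comm_group "Q b" by (rule Q_comm_group[OF assms])
  have "comm_group (\<Gamma> b)"
    by (rule group.group_comm_groupI)
      (auto simp: mult_DirProd' Q.m_comm simp del: mult_FactGroup intro!: DirProd_group Q.group_axioms)
  then show ?thesis
    by (intro graded_group.intro graded_group_axioms.intro) (auto simp: mult_DirProd')
qed

section \<open>A-classes fixed by a conjugation\<close>

definition fixed_cosets :: "'a \<Rightarrow> 'a \<Rightarrow> 'a set set" where
  "fixed_cosets t b = {q \<in> carrier (Q b). conj_by t ` (q #> b) = q #> b}"

lemma dcoset_fixed_iff:
  assumes "t \<in> carrier G" "b \<in> carrier G" "a \<in> A"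
  shows "dcoset b a \<in> fixed_cosets t b \<longleftrightarrow> conj_by t (a \<otimes> b) \<otimes> inv (a \<otimes> b) \<in> displacement b"
proof -
  have c: "a \<otimes> b \<in> carrier G"
    using assms A_carrier by simp
  have "dcoset b a \<in> fixed_cosets t b \<longleftrightarrow> a_class (conj_by t (a \<otimes> b)) = a_class (a \<otimes> b)"
    using assms c by (simp add: fixed_cosets_def carrier_Q dcoset_rcoset conj_by_a_class)
  also have "\<dots> \<longleftrightarrow> conj_by t (a \<otimes> b) \<in> a_class (a \<otimes> b)"
    using a_class_eqI[OF _ c] a_class_self[of "conj_by t (a \<otimes> b)"] assms(1) c by auto
  also have "\<dots> \<longleftrightarrow> conj_by t (a \<otimes> b) \<otimes> inv (a \<otimes> b) \<in> displacement b"
    unfolding a_class_eq_coset[OF assms(3,2)]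
    using assms c by (intro subgroup.rcos_module displacement_subgroup_G group_axioms) auto
  finally show ?thesis .
qed

text \<open>One fixed element a0 serves as origin. If d = t (a0 b) t^-1 (a0 b)^-1, the corresponding
  element for c a0 b is (t c t^-1 c^-1) d. Since d lies in \<open>displacement b\<close>, c a0 is
  fixed iff t c t^-1 c^-1 lies there too, and this is a subgroup condition on c. There may be no
  origin, for instance when t and b do not commute modulo A.\<close>

lemma fixed_cosets_eq_rcoset:
  assumes t: "t \<in> carrier G" and b: "b \<in> carrier G" and "fixed_cosets t b \<noteq> {}"
  shows "\<exists>H e. subgroup H (\<Gamma> b) \<and> e \<in> carrier (\<Gamma> b) \<and> fixed_cosets t b \<times> UNIV = H #>\<^bsub>\<Gamma> b\<^esub> e"
proof -
  interpret GA: comm_group GA by (rule GA_comm_group)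
  interpret Q: comm_group "Q b" by (rule Q_comm_group[OF b])
  interpret D: subgroup "displacement b" G by (rule displacement_subgroup_G[OF b])
  obtain a0 where a0: "a0 \<in> A" "dcoset b a0 \<in> fixed_cosets t b"
    using assms(3) by (auto simp: fixed_cosets_def carrier_Q)
  define d where "d = conj_by t (a0 \<otimes> b) \<otimes> inv (a0 \<otimes> b)"
  have d: "d \<in> displacement b"
    using a0 t b by (simp add: d_def dcoset_fixed_iff)
  then have dA: "d \<in> A"
    using displacement_subset b by blast
  define B where "B = {c \<in> A. conj_by t c \<otimes> inv c \<in> displacement b}"
  have fixed_iff: "dcoset b (c \<otimes> a0) \<in> fixed_cosets t b \<longleftrightarrow> c \<in> B" if c: "c \<in> A" for c
  proof -
    have "conj_by t (c \<otimes> a0 \<otimes> b) \<otimes> inv (c \<otimes> a0 \<otimes> b) = conj_by t c \<otimes> (d \<otimes> inv c)"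
      unfolding d_def using c a0 t b A_carrier by (simp add: conj_by_mult inv_mult_group m_assoc)
    also have "\<dots> = (conj_by t c \<otimes> inv c) \<otimes> d"
      using c dA t A_comm[of d "inv c"] by (simp add: m_assoc A_carrier)
    finally have "conj_by t (c \<otimes> a0 \<otimes> b) \<otimes> inv (c \<otimes> a0 \<otimes> b) = (conj_by t c \<otimes> inv c) \<otimes> d" .
    moreover have "x \<otimes> d \<in> displacement b \<longleftrightarrow> x \<in> displacement b" if x: "x \<in> carrier G" for x
    proof
      assume "x \<otimes> d \<in> displacement b"
      then have "(x \<otimes> d) \<otimes> inv d \<in> displacement b"
        by (rule D.m_closed[OF _ D.m_inv_closed[OF d]])
      then show "x \<in> displacement b"
        using x dA by (simp add: m_assoc A_carrier)
    qed (use d in simp)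
    ultimately show ?thesis
      using c a0 t b A_carrier by (simp add: dcoset_fixed_iff B_def)
  qed
  have "subgroup B GA"
  proof (rule GA.subgroupI)
    show "B \<noteq> {}"
      using t by (auto simp: B_def intro!: exI[of _ \<one>])
  next
    fix c assume c: "c \<in> B"
    then have "conj_by t (inv c) \<otimes> inv (inv c) = inv (conj_by t c \<otimes> inv c)"
      using t A_carrier A_comm[of "inv (conj_by t c)" c] by (simp add: B_def conj_by_inv inv_mult_group)
    then show "inv\<^bsub>GA\<^esub> c \<in> B"
      using c D.m_inv_closed by (simp add: B_def m_inv_consistent[OF A_subgroup])
  next
    fix c c' assume c: "c \<in> B" "c' \<in> B"
    have "conj_by t (c \<otimes> c') \<otimes> inv (c \<otimes> c') = conj_by t c \<otimes> ((conj_by t c' \<otimes> inv c') \<otimes> inv c)"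
      using c t A_carrier by (simp add: B_def conj_by_mult inv_mult_group m_assoc)
    also have "\<dots> = (conj_by t c \<otimes> inv c) \<otimes> (conj_by t c' \<otimes> inv c')"
      using c t A_comm[of "conj_by t c' \<otimes> inv c'" "inv c"] by (simp add: B_def m_assoc A_carrier)
    finally show "c \<otimes>\<^bsub>GA\<^esub> c' \<in> B"
      using c by (simp add: B_def)
  qed (auto simp: B_def)
  moreover have "group_hom GA (Q b) (dcoset b)"
    using dcoset_hom[OF b] by (intro group_hom.intro group_hom_axioms.intro GA.group_axioms Q.group_axioms)
  ultimately have "subgroup (dcoset b ` B) (Q b)"
    by (intro group_hom.subgroup_img_is_subgroup)
  then have "subgroup (dcoset b ` B \<times> UNIV) (\<Gamma> b)"
    using group.subgroup_self[OF group_integer_group]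
    by (intro DirProd_subgroups Q.group_axioms group_integer_group) simp_all
  moreover have "fixed_cosets t b \<times> UNIV = (dcoset b ` B \<times> UNIV) #>\<^bsub>\<Gamma> b\<^esub> (dcoset b a0, 0)"
  proof (intro equalityI subsetI)
    fix x :: "'a set \<times> int" assume "x \<in> fixed_cosets t b \<times> UNIV"
    then obtain q m where x: "x = (q, m)" "q \<in> fixed_cosets t b"
      by blast
    then obtain a where a: "a \<in> A" "q = dcoset b a"
      by (auto simp: fixed_cosets_def carrier_Q)
    define c where "c = a \<otimes> inv a0"
    have c: "c \<in> A" "c \<otimes> a0 = a"
      using a a0 by (auto simp: c_def m_assoc A_carrier)
    then have "c \<in> B"
      using fixed_iff[OF c(1)] x a by simp
    moreover have "x = (dcoset b c, m) \<otimes>\<^bsub>\<Gamma> b\<^esub> (dcoset b a0, 0)"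
      using c a0 a b x by (simp add: dcoset_mult del: mult_FactGroup)
    ultimately show "x \<in> (dcoset b ` B \<times> UNIV) #>\<^bsub>\<Gamma> b\<^esub> (dcoset b a0, 0)"
      unfolding r_coset_def by blast
  next
    fix x assume "x \<in> (dcoset b ` B \<times> UNIV) #>\<^bsub>\<Gamma> b\<^esub> (dcoset b a0, 0)"
    then obtain c m where c: "c \<in> B" "x = (dcoset b c, m) \<otimes>\<^bsub>\<Gamma> b\<^esub> (dcoset b a0, 0)"
      unfolding r_coset_def by blast
    then have "x = (dcoset b (c \<otimes> a0), m)" "c \<in> A"
      using a0 b by (simp_all add: B_def dcoset_mult del: mult_FactGroup)
    then show "x \<in> fixed_cosets t b \<times> UNIV"
      using fixed_iff c(1) by simp
  qed
  moreover have "(dcoset b a0, 0) \<in> carrier (\<Gamma> b)"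
    using a0 by (simp add: carrier_Q)
  ultimately show ?thesis
    by blast
qed

end

section \<open>The growth series\<close>

context weighted_generators begin

text \<open>Stable under conjugation, as Burnside's lemma requires. If S generates G, it is the
  union of the classes of weight at most n, by \<open>class_weight_le_iff\<close>.\<close>

definition conj_ball :: "nat \<Rightarrow> 'a set" where
  "conj_ball n = {conj_by x (val w) | x w. x \<in> carrier G \<and> w \<in> lists S \<and> wt w \<le> n}"

lemma conj_ball_subset: "conj_ball n \<subseteq> carrier G"
proof
  fix g assume "g \<in> conj_ball n"
  then obtain x w where "x \<in> carrier G" "w \<in> lists S" "g = conj_by x (val w)"
    unfolding conj_ball_def by blast
  then show "g \<in> carrier G"
    by (simp del: in_lists_conv_set)
qed

lemma conj_ball_conj:
  assumes "x \<in> carrier G" "g \<in> conj_ball n"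
  shows "conj_by x g \<in> conj_ball n"
proof -
  obtain y w where "y \<in> carrier G" "w \<in> lists S" "wt w \<le> n" "g = conj_by y (val w)"
    using assms(2) unfolding conj_ball_def by blast
  then have "conj_by x g = conj_by (x \<otimes> y) (val w)" "x \<otimes> y \<in> carrier G" "w \<in> lists S" "wt w \<le> n"
    using assms(1) by (simp_all add: conj_by_conj_by del: in_lists_conv_set)
  then show ?thesis
    unfolding conj_ball_def by blast
qed

lemma length_le_wt: "w \<in> lists S \<Longrightarrow> length w \<le> wt w"
proof (induction w)
  case (Cons s w)
  then show ?case
    using \<omega>_pos[of s] by (simp add: word_weight_def)
qed simp

lemma finite_words: "finite {w \<in> lists S. wt w \<le> n}"
proof (rule finite_subset)
  show "{w \<in> lists S. wt w \<le> n} \<subseteq> {w. set w \<subseteq> S \<and> length w \<le> n}"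
    using length_le_wt by fastforce
qed (simp add: S_finite finite_lists_length_le)

text \<open>The ball may be infinite, but up to A-classes its conjugators can be taken from
  T.\<close>

lemma finite_a_classes_conj_ball: "finite (a_class ` conj_ball n)"
proof (rule finite_subset)
  show "a_class ` conj_ball n \<subseteq> (\<lambda>(t, w). a_class (conj_by t (val w))) ` (T \<times> {w \<in> lists S. wt w \<le> n})"
  proof
    fix y assume "y \<in> a_class ` conj_ball n"
    then obtain x w where x: "x \<in> carrier G" and w: "w \<in> lists S" "wt w \<le> n" and y: "y = a_class (conj_by x (val w))"
      unfolding conj_ball_def by blast
    have "y = a_class (conj_by (rep x) (val w))"
      unfolding y using x rep[OF x] T_carrier val_closed[OF w(1)] by (intro a_class_conj_by_coset) auto
    then show "y \<in> (\<lambda>(t, w). a_class (conj_by t (val w))) ` (T \<times> {w \<in> lists S. wt w \<le> n})"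
      using rep(1)[OF x] w by (intro image_eqI[of _ _ "(rep x, w)"]) auto
  qed
qed (simp add: T_finite finite_words)

text \<open>The last condition places t u t^-1 in the coset A b.\<close>

definition indices :: "'a \<Rightarrow> ('a \<times> 'a list) set" where
  "indices b = {(t, u). t \<in> T \<and> u \<in> lists S \<and> length u \<le> loop_bound \<and> conj_by t (val u) \<otimes> inv b \<in> A}"

definition push :: "'a \<Rightarrow> 'a \<Rightarrow> 'a \<times> int \<Rightarrow> 'a set \<times> int" where
  "push b t = (\<lambda>(a, m). (dcoset b (conj_by t a), m))"

text \<open>For a in the loop monoid of u, t (a u) t^-1 = (t a t^-1) (t u t^-1 b^-1) b. Dropping b
  and passing to \<open>Q b\<close> gives a translate of the monoid generated by the pushed loops;
  the second component keeps the weight bound.\<close>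

definition piece :: "'a \<Rightarrow> 'a \<times> 'a list \<Rightarrow> ('a set \<times> int) set" where
  "piece b = (\<lambda>(t, u). {(dcoset b (conj_by t (val u) \<otimes> inv b), int (wt u))}
     <#>\<^bsub>\<Gamma> b\<^esub> generated_submonoid (\<Gamma> b) (push b t ` loops (visits u)))"

lemma finite_indices: "finite (indices b)"
proof (rule finite_subset)
  show "indices b \<subseteq> T \<times> {u. set u \<subseteq> S \<and> length u \<le> loop_bound}"
    by (auto simp: indices_def)
qed (simp add: T_finite S_finite finite_lists_length_le)

lemma periodic_piece:
  assumes b: "b \<in> carrier G" and i: "i \<in> indices b"
  shows "graded_group.periodic (\<Gamma> b) snd (piece b i)"
proof -
  interpret \<Gamma>: graded_group "\<Gamma> b" snd by (rule \<Gamma>_graded_group[OF b])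
  obtain t u where tu: "i = (t, u)" "t \<in> T" "conj_by t (val u) \<otimes> inv b \<in> A"
    using i by (auto simp: indices_def)
  have *: "push b t l \<in> carrier (\<Gamma> b) \<and> 1 \<le> snd (push b t l)" if "l \<in> loops (visits u)" for l
  proof -
    obtain a m where "l = (a, m)" "a \<in> A" "1 \<le> m"
      using loops_subset \<open>l \<in> loops (visits u)\<close> by blast
    then show ?thesis
      using T_carrier[OF tu(2)] by (simp add: push_def carrier_Q)
  qed
  have "\<exists>C L. finite C \<and> C \<subseteq> carrier (\<Gamma> b) \<and> (\<forall>c\<in>C. 0 \<le> snd c) \<and> finite L \<and> L \<subseteq> carrier (\<Gamma> b)
    \<and> (\<forall>l\<in>L. 1 \<le> snd l) \<and> piece b i = C <#>\<^bsub>\<Gamma> b\<^esub> generated_submonoid (\<Gamma> b) L"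
  proof (intro exI conjI)
    show "piece b i = {(dcoset b (conj_by t (val u) \<otimes> inv b), int (wt u))}
      <#>\<^bsub>\<Gamma> b\<^esub> generated_submonoid (\<Gamma> b) (push b t ` loops (visits u))"
      by (simp add: piece_def tu(1))
    show "push b t ` loops (visits u) \<subseteq> carrier (\<Gamma> b)" "\<forall>l\<in>push b t ` loops (visits u). 1 \<le> snd l"
      using * by blast+
  qed (use tu(3) in \<open>simp_all add: carrier_Q loops_finite\<close>)
  then show ?thesis
    by (simp only: \<Gamma>.periodic_def)
qed

lemma mem_piece_iff:
  assumes b: "b \<in> carrier G" and t: "t \<in> T"
  shows "(q, k) \<in> piece b (t, u) \<longleftrightarrow> (\<exists>a m. (a, m) \<in> loop_monoid (visits u) \<and> k = int (wt u) + m
    \<and> q = dcoset b (conj_by t (val u) \<otimes> inv b) \<otimes>\<^bsub>Q b\<^esub> dcoset b (conj_by t a))"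
proof -
  have tc: "t \<in> carrier G"
    using t by (rule T_carrier)
  have "generated_submonoid (\<Gamma> b) (push b t ` loops (visits u)) = push b t ` loop_monoid (visits u)"
  proof (rule generated_submonoid_image)
    show "push b t \<one>\<^bsub>G \<times>\<times> integer_group\<^esub> = \<one>\<^bsub>\<Gamma> b\<^esub>"
      using tc dcoset_one[OF b] by (simp add: push_def del: one_FactGroup)
    fix x y assume "x \<in> loops (visits u)" "y \<in> loop_monoid (visits u)"
    then obtain a m a' m' where "x = (a, m)" "a \<in> A" "y = (a', m')" "a' \<in> A"
      using loops_subset loop_monoid_subset by blast
    then show "push b t (x \<otimes>\<^bsub>G \<times>\<times> integer_group\<^esub> y) = push b t x \<otimes>\<^bsub>\<Gamma> b\<^esub> push b t y"
      using tc b by (simp add: push_def conj_by_mult dcoset_mult A_carrier del: mult_FactGroup)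
  qed
  then have "(q, k) \<in> piece b (t, u) \<longleftrightarrow> (\<exists>z\<in>loop_monoid (visits u).
      (q, k) = (dcoset b (conj_by t (val u) \<otimes> inv b), int (wt u)) \<otimes>\<^bsub>\<Gamma> b\<^esub> push b t z)"
    unfolding piece_def prod.case by (simp only: mem_set_mult_image bex_simps) blast
  also have "\<dots> \<longleftrightarrow> (\<exists>a m. (a, m) \<in> loop_monoid (visits u) \<and> k = int (wt u) + m
    \<and> q = dcoset b (conj_by t (val u) \<otimes> inv b) \<otimes>\<^bsub>Q b\<^esub> dcoset b (conj_by t a))"
    by (auto simp: push_def Bex_def simp del: mult_FactGroup)
  finally show ?thesis .
qed

text \<open>A conjugate x w x^-1 has the A-class of t w t^-1 for t = \<open>rep x\<close>, so
  finitely many conjugators suffice, and \<open>word_value_weight_iff\<close> splits the value of w.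
  Conversely, a member of a piece is an A-class that contains some t w t^-1, and the ball is stable
  under conjugation.\<close>

lemma mem_pieces_iff:
  assumes b: "b \<in> carrier G" and a: "a \<in> A"
  shows "(dcoset b a, int n) \<in> (\<Union>i\<in>indices b. piece b i) \<longleftrightarrow> a \<otimes> b \<in> conj_ball n"
proof
  assume "(dcoset b a, int n) \<in> (\<Union>i\<in>indices b. piece b i)"
  then obtain t u where tu: "t \<in> T" "u \<in> lists S" "length u \<le> loop_bound" "conj_by t (val u) \<otimes> inv b \<in> A"
      and "(dcoset b a, int n) \<in> piece b (t, u)"
    unfolding indices_def by blast
  then obtain a' m where am: "(a', m) \<in> loop_monoid (visits u)" "int n = int (wt u) + m"
      and eq: "dcoset b a = dcoset b (conj_by t (val u) \<otimes> inv b) \<otimes>\<^bsub>Q b\<^esub> dcoset b (conj_by t a')"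
    unfolding mem_piece_iff[OF b tu(1)] by blast
  have t: "t \<in> carrier G" and u: "val u \<in> carrier G" and a': "a' \<in> A"
    using T_carrier[OF tu(1)] val_closed[OF tu(2)] loop_monoid_subset[OF am(1)] by auto
  obtain w where w: "w \<in> lists S" "val w = a' \<otimes> val u" "wt w \<le> n"
  proof -
    have "a' \<otimes> val u \<in> carrier G"
      using a' u A_carrier by simp
    moreover have "int n = m + int (wt u)"
      using am(2) by simp
    ultimately show thesis
      using word_value_weight_iff[of "a' \<otimes> val u" n] tu(2,3) am(1) that by blast
  qed
  define z where "z = conj_by t (val u) \<otimes> inv b"
  have z: "z \<in> A" "conj_by t (val u) = z \<otimes> b"
    using tu(4) t u b by (simp_all add: z_def m_assoc)
  have "dcoset b a = dcoset b (z \<otimes> conj_by t a')"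
    unfolding eq z_def[symmetric] using z t a' b by (intro dcoset_mult) auto
  then have "dcoset b a = dcoset b (conj_by t a' \<otimes> z)"
    using z t a' A_comm by simp
  then have "a_class (a \<otimes> b) = a_class (conj_by t a' \<otimes> z \<otimes> b)"
    using a b z t a' by (simp add: a_class_eq_iff)
  also have "conj_by t a' \<otimes> z \<otimes> b = conj_by t (val w)"
    using t a' u z b w(2) A_carrier by (simp add: conj_by_mult m_assoc)
  finally have "a \<otimes> b \<in> a_class (conj_by t (val w))"
    using a b A_carrier a_class_self[of "a \<otimes> b"] by simp
  then obtain x where "x \<in> A" "a \<otimes> b = conj_by x (conj_by t (val w))"
    unfolding a_class_def by blast
  moreover have "conj_by t (val w) \<in> conj_ball n"
    using t w unfolding conj_ball_def by blast
  ultimately show "a \<otimes> b \<in> conj_ball n"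
    using conj_ball_conj A_carrier by simp
next
  assume "a \<otimes> b \<in> conj_ball n"
  then obtain x w where x: "x \<in> carrier G" and w: "w \<in> lists S" "wt w \<le> n" and ab: "a \<otimes> b = conj_by x (val w)"
    unfolding conj_ball_def by blast
  define t where "t = rep x"
  have t: "t \<in> T" "t \<in> carrier G" "A #> t = A #> x"
    using rep[OF x] T_carrier by (simp_all add: t_def)
  have vw: "val w \<in> carrier G"
    using w(1) by (rule val_closed)
  have eq: "a_class (a \<otimes> b) = a_class (conj_by t (val w))"
    unfolding ab using a_class_conj_by_coset[OF x t(2) t(3)[symmetric] vw] .
  have "conj_by t (val w) \<in> a_class (a \<otimes> b)"
    unfolding eq using t(2) vw by (intro a_class_self) simp
  \<comment> \<open>The two elements are only A-conjugate; the factor d between them disappears in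
    \<open>Q b\<close>.\<close>
  then obtain d where d: "d \<in> displacement b" "conj_by t (val w) = d \<otimes> (a \<otimes> b)"
    unfolding a_class_eq_coset[OF a b] r_coset_def by blast
  have dA: "d \<in> A"
    using d displacement_subset b by blast
  obtain u a' m where u: "u \<in> lists S" "length u \<le> loop_bound"
      and am: "(a', m) \<in> loop_monoid (visits u)" "val w = a' \<otimes> val u" "int n = m + int (wt u)"
    using word_value_weight_iff[OF vw, of n] w by blast
  have a': "a' \<in> A" and vu: "val u \<in> carrier G"
    using loop_monoid_subset[OF am(1)] val_closed[OF u(1)] by auto
  define z where "z = conj_by t (val u) \<otimes> inv b"
  have "conj_by t a' \<otimes> conj_by t (val u) = d \<otimes> (a \<otimes> b)"
    using d(2) t a' vu A_carrier by (simp add: am(2) conj_by_mult)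
  then have "conj_by t a' \<otimes> conj_by t (val u) \<otimes> inv b = d \<otimes> (a \<otimes> b) \<otimes> inv b"
    by (simp only:)
  then have cz: "conj_by t a' \<otimes> z = d \<otimes> a"
    using t a' vu b a dA A_carrier by (simp add: z_def m_assoc)
  then have z: "inv (conj_by t a') \<otimes> (d \<otimes> a) = z"
    using t a' vu b A_carrier by (simp add: z_def m_assoc[symmetric] flip: cz)
  have "inv (conj_by t a') \<otimes> (d \<otimes> a) \<in> A"
    using dA a t(2) a' by simp
  then have zA: "z \<in> A"
    by (simp only: z)
  have "dcoset b (z \<otimes> conj_by t a') = dcoset b (d \<otimes> a)"
    using cz zA t a' A_comm by simp
  also have "\<dots> = dcoset b a"
  proof (subst dcoset_eq_iff)
    show "d \<otimes> a \<otimes> inv a \<in> displacement b"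
      using d dA a A_carrier by (simp add: m_assoc)
  qed (use dA a b in auto)
  finally have "dcoset b a = dcoset b z \<otimes>\<^bsub>Q b\<^esub> dcoset b (conj_by t a')"
    using zA t a' b by (simp add: dcoset_mult del: mult_FactGroup)
  then have "(dcoset b a, int n) \<in> piece b (t, u)"
    unfolding mem_piece_iff[OF b t(1)] using am z_def by (metis add.commute)
  moreover have "(t, u) \<in> indices b"
    using t u zA by (simp add: indices_def z_def)
  ultimately show "(dcoset b a, int n) \<in> (\<Union>i\<in>indices b. piece b i)"
    by blast
qed

definition fixed_part :: "'a \<Rightarrow> 'a \<Rightarrow> ('a set \<times> int) set" where
  "fixed_part t b = (\<Union>i\<in>indices b. piece b i) \<inter> (fixed_cosets t b \<times> UNIV)"

lemma rational_count_fixed_part: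
  assumes "t \<in> carrier G" "b \<in> carrier G"
  shows "rational_count snd (fixed_part t b)"
proof (cases "fixed_cosets t b = {}")
  case True
  then show ?thesis
    by (simp add: fixed_part_def)
next
  case False
  then obtain H e where He: "subgroup H (\<Gamma> b)" "e \<in> carrier (\<Gamma> b)"
      "fixed_cosets t b \<times> UNIV = H #>\<^bsub>\<Gamma> b\<^esub> e"
    using fixed_cosets_eq_rcoset[OF assms] by blast
  show ?thesis
    unfolding fixed_part_def He(3)
    using He assms(2) finite_indices periodic_piece
    by (intro graded_group.rational_count_UN_periodic[OF \<Gamma>_graded_group]) auto
qed

text \<open>Every A-class lies in a single coset A b with b in T, so the classes are sorted by b,
  and inside A b they correspond to elements of \<open>Q b\<close>.\<close>

lemma card_fixed_a_classes:
  assumes t: "t \<in> carrier G"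
  shows "card {y \<in> a_class ` conj_ball n. conj_by t ` y = y}
    = (\<Sum>b\<in>T. card {e \<in> fixed_part t b. snd e = int n})"
proof -
  let ?F = "\<lambda>b. {e \<in> fixed_part t b. snd e = int n}"
  have mem: "(dcoset b a, int n) \<in> fixed_part t b \<longleftrightarrow> a \<otimes> b \<in> conj_ball n \<and> conj_by t ` a_class (a \<otimes> b) = a_class (a \<otimes> b)"
    if "b \<in> T" "a \<in> A" for a b
    using that T_carrier[OF that(1)] mem_pieces_iff[of b a n]
    by (simp add: fixed_part_def fixed_cosets_def carrier_Q dcoset_rcoset)
  have "bij_betw (\<lambda>(b, q, m). q #> b) (SIGMA b:T. ?F b) {y \<in> a_class ` conj_ball n. conj_by t ` y = y}"
  proof (rule bij_betw_imageI)
    have F: "\<exists>a\<in>A. e = (dcoset b a, int n)" if "e \<in> ?F b" for b e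
      using that by (cases e) (auto simp: fixed_part_def fixed_cosets_def carrier_Q)
    show "inj_on (\<lambda>(b, q, m). q #> b) (SIGMA b:T. ?F b)"
    proof (rule inj_onI)
      fix x x' assume x: "x \<in> (SIGMA b:T. ?F b)" "x' \<in> (SIGMA b:T. ?F b)"
        and eq: "(\<lambda>(b, q, m). q #> b) x = (\<lambda>(b, q, m). q #> b) x'"
      obtain b a where a: "b \<in> T" "a \<in> A" "x = (b, dcoset b a, int n)"
        using x(1) F by blast
      obtain b' a' where a': "b' \<in> T" "a' \<in> A" "x' = (b', dcoset b' a', int n)"
        using x(2) F by blast
      have c: "b \<in> carrier G" "b' \<in> carrier G"
        using a a' T_carrier by auto
      have cl: "a_class (a \<otimes> b) = a_class (a' \<otimes> b')"
        using eq a a' c by (simp add: dcoset_rcoset)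
      have "a \<otimes> b \<in> a_class (a' \<otimes> b')"
        unfolding cl[symmetric] using a c A_carrier by (intro a_class_self) simp
      then obtain d where d: "d \<in> displacement b'" "a \<otimes> b = d \<otimes> (a' \<otimes> b')"
        unfolding a_class_eq_coset[OF a'(2) c(2)] r_coset_def by blast
      have dA: "d \<in> A"
        using d displacement_subset[OF c(2)] by blast
      \<comment> \<open>The class determines b: its elements all lie in one coset of A, which has
        only one representative in T.\<close>
      have "A #> b = A #> (a \<otimes> b)"
        using a c by (simp add: coset_mult_assoc[symmetric] subset A_carrier rcos_const[OF group_axioms])
      also have "\<dots> = A #> ((d \<otimes> a') \<otimes> b')"
        using d dA a' c A_carrier by (simp add: m_assoc)
      also have "\<dots> = A #> b'"
        using dA a' c by (subst coset_mult_assoc[symmetric]) (simp_all add: subset A_carrier rcos_const[OF group_axioms])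
      finally have "b = b'"
        using a a' by (intro T_eqI)
      then show "x = x'"
        using cl a a' c by (simp add: a_class_eq_iff)
    qed
    show "(\<lambda>(b, q, m). q #> b) ` (SIGMA b:T. ?F b) = {y \<in> a_class ` conj_ball n. conj_by t ` y = y}"
    proof (intro equalityI subsetI)
      fix y assume "y \<in> (\<lambda>(b, q, m). q #> b) ` (SIGMA b:T. ?F b)"
      then obtain b e where be: "b \<in> T" "e \<in> ?F b" "y = fst e #> b"
        by auto
      then obtain a where a: "a \<in> A" "e = (dcoset b a, int n)"
        using F by blast
      then have "y = a_class (a \<otimes> b)"
        using be T_carrier by (simp add: dcoset_rcoset)
      then show "y \<in> {y \<in> a_class ` conj_ball n. conj_by t ` y = y}"
        using mem[OF be(1) a(1)] be(2) a(2) by simp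
    next
      fix y assume "y \<in> {y \<in> a_class ` conj_ball n. conj_by t ` y = y}"
      then obtain g where g: "g \<in> conj_ball n" "y = a_class g" "conj_by t ` y = y"
        by blast
      then have gc: "g \<in> carrier G"
        using conj_ball_subset by blast
      define b where "b = rep g"
      have b: "b \<in> T" "b \<in> carrier G"
        using rep[OF gc] T_carrier by (simp_all add: b_def)
      define a where "a = g \<otimes> inv b"
      have a: "a \<in> A" "a \<otimes> b = g"
        using rep(2)[OF gc] coset_eq_iff_A[of g b] gc b by (simp_all add: a_def b_def m_assoc)
      have "(dcoset b a, int n) \<in> ?F b"
        using mem[OF b(1) a(1)] a g by simp
      moreover have "y = dcoset b a #> b"
        using a b g by (simp add: dcoset_rcoset)
      ultimately show "y \<in> (\<lambda>(b, q, m). q #> b) ` (SIGMA b:T. ?F b)"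
        using b by (intro image_eqI[of _ _ "(b, dcoset b a, int n)"]) auto
    qed
  qed
  then have "card {y \<in> a_class ` conj_ball n. conj_by t ` y = y} = card (SIGMA b:T. ?F b)"
    by (rule bij_betw_same_card[symmetric])
  also have "\<dots> = (\<Sum>b\<in>T. card (?F b))"
    using T_finite rational_count_finite_fibre[OF rational_count_fixed_part[OF t]] T_carrier
    by (intro card_SigmaI) auto
  finally show ?thesis .
qed

lemma finite_conj_classes: "finite (conj_class ` conj_ball n)"
proof (rule finite_subset)
  show "conj_class ` conj_ball n \<subseteq> conj_class ` val ` {w \<in> lists S. wt w \<le> n}"
  proof
    fix c assume "c \<in> conj_class ` conj_ball n"
    then obtain x w where x: "x \<in> carrier G" and w: "w \<in> lists S" "wt w \<le> n" and c: "c = conj_class (conj_by x (val w))"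
      unfolding conj_ball_def by blast
    have "c = conj_class (val w)"
      unfolding c using x val_closed[OF w(1)] by (intro conj_class_eqI) (auto simp: conj_class_def)
    then show "c \<in> conj_class ` val ` {w \<in> lists S. wt w \<le> n}"
      using w by blast
  qed
qed (simp add: finite_words)

text \<open>Burnside yields the coefficients only up to the factor \<open>card T\<close>, which is
  cancelled as a constant polynomial.\<close>

theorem rational_cumulative_series:
  "rational_fps (Abs_fps (\<lambda>n. int (card (conj_class ` conj_ball n))))"
proof (rule rational_fps_cancel_poly)
  have "T \<noteq> {}"
    using rep(1)[of \<one>] by auto
  then show "[:int (card T):] \<noteq> 0"
    using T_finite by simp
  have "int (card T) * int (card (conj_class ` conj_ball n))
      = (\<Sum>t\<in>T. \<Sum>b\<in>T. int (card {e \<in> fixed_part t b. snd e = int n}))" for n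
  proof -
    have "card T * card (conj_class ` conj_ball n)
        = (\<Sum>t\<in>T. card {y \<in> a_class ` conj_ball n. conj_by t ` y = y})"
      using conj_ball_subset conj_ball_conj finite_a_classes_conj_ball by (intro card_conj_classes[symmetric])
    also have "\<dots> = (\<Sum>t\<in>T. \<Sum>b\<in>T. card {e \<in> fixed_part t b. snd e = int n})"
      by (intro sum.cong refl card_fixed_a_classes T_carrier)
    finally show ?thesis
      by (simp flip: of_nat_mult of_nat_sum)
  qed
  then have "fps_of_poly [:int (card T):] * Abs_fps (\<lambda>n. int (card (conj_class ` conj_ball n)))
      = (\<Sum>t\<in>T. \<Sum>b\<in>T. counting_series snd (fixed_part t b))"
    by (simp add: fps_eq_iff fps_of_poly_const fps_sum_nth counting_series_def)
  moreover have "rational_fps (\<Sum>t\<in>T. \<Sum>b\<in>T. counting_series snd (fixed_part t b))"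
    using rational_count_fixed_part T_carrier by (intro rational_fps_sum) (simp add: rational_count_def)
  ultimately show "rational_fps (fps_of_poly [:int (card T):] * Abs_fps (\<lambda>n. int (card (conj_class ` conj_ball n))))"
    by (simp only:)
qed

section \<open>From balls to the growth series\<close>

lemma conjugacy_classes_eq: "conjugacy_classes G = conj_class ` carrier G"
proof -
  have "orbit G (\<lambda>g. \<lambda>h\<in>carrier G. g \<otimes> h \<otimes> inv g) x = conj_class x" if "x \<in> carrier G" for x
    using that by (auto simp: orbit_def conj_class_def conj_by_def)
  then show ?thesis
    unfolding conjugacy_classes_def orbits_def by auto
qed

text \<open>The given word makes this an infimum over a nonempty set of naturals, hence
  attained.\<close>

lemma elem_weight_le_iff:
  assumes "w \<in> lists S" "val w = g"
  shows "elem_weight G S \<omega> g \<le> n \<longleftrightarrow> (\<exists>w\<in>lists S. val w = g \<and> wt w \<le> n)"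
proof
  let ?W = "wt ` {w \<in> lists S. val w = g}"
  assume "elem_weight G S \<omega> g \<le> n"
  moreover have "elem_weight G S \<omega> g \<in> ?W"
    unfolding elem_weight_def using assms by (intro Inf_nat_def1) auto
  ultimately show "\<exists>w\<in>lists S. val w = g \<and> wt w \<le> n"
    by auto
next
  assume "\<exists>w\<in>lists S. val w = g \<and> wt w \<le> n"
  then obtain v where v: "v \<in> lists S" "val v = g" "wt v \<le> n" by blast
  then have "elem_weight G S \<omega> g \<le> wt v"
    unfolding elem_weight_def by (intro cINF_lower) auto
  then show "elem_weight G S \<omega> g \<le> n"
    using v(3) by simp
qed

lemma class_weight_le_iff:
  assumes gen: "\<And>g. g \<in> carrier G \<Longrightarrow> \<exists>w\<in>lists S. val w = g" and g: "g \<in> carrier G"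
  shows "class_weight G S \<omega> (conj_class g) \<le> n \<longleftrightarrow> g \<in> conj_ball n"
proof
  assume "class_weight G S \<omega> (conj_class g) \<le> n"
  moreover have "class_weight G S \<omega> (conj_class g) \<in> elem_weight G S \<omega> ` conj_class g"
    unfolding class_weight_def using conj_class_self[OF g] by (intro Inf_nat_def1) auto
  ultimately obtain h where h: "h \<in> conj_class g" "elem_weight G S \<omega> h \<le> n"
    by auto
  then have hc: "h \<in> carrier G"
    using conj_class_subset g by blast
  then obtain w where w: "w \<in> lists S" "val w = h" "wt w \<le> n"
    using h(2) elem_weight_le_iff gen by metis
  have "conj_class h = conj_class g"
    using h(1) g by (rule conj_class_eqI)
  then have "g \<in> conj_class h"
    using conj_class_self[OF g] by simp
  then obtain x where "x \<in> carrier G" "g = conj_by x h"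
    unfolding conj_class_def by blast
  then show "g \<in> conj_ball n"
    using w unfolding conj_ball_def by blast
next
  assume "g \<in> conj_ball n"
  then obtain x w where x: "x \<in> carrier G" and w: "w \<in> lists S" "wt w \<le> n" and gx: "g = conj_by x (val w)"
    unfolding conj_ball_def by blast
  have "val w = conj_by (inv x) g"
    using x val_closed[OF w(1)] by (simp add: gx conj_by_conj_by)
  then have "val w \<in> conj_class g"
    using x unfolding conj_class_def by blast
  then have "class_weight G S \<omega> (conj_class g) \<le> elem_weight G S \<omega> (val w)"
    unfolding class_weight_def by (intro cINF_lower) auto
  also have "\<dots> \<le> n"
    using elem_weight_le_iff[OF w(1) refl] w by blast
  finally show "class_weight G S \<omega> (conj_class g) \<le> n" .
qed

theorem rational_conjugacy_growth_series:
  assumes gen: "\<And>g. g \<in> carrier G \<Longrightarrow> \<exists>w\<in>lists S. val w = g"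
  shows "rational_fps (conjugacy_growth_series G S \<omega>)"
proof -
  let ?K = "\<lambda>n. conj_class ` conj_ball n"
  have K: "?K n = {c \<in> conjugacy_classes G. class_weight G S \<omega> c \<le> n}" for n
    using class_weight_le_iff[OF gen] conj_ball_subset unfolding conjugacy_classes_eq by blast
  \<comment> \<open>Differences of consecutive balls, that is, a factor 1 - z. At n = 0 the
    truncated n - 1 would be 0 again, so that coefficient has nothing to subtract.\<close>
  have "int (card {c \<in> conjugacy_classes G. class_weight G S \<omega> c = n})
      = int (card (?K n)) - (if n = 0 then 0 else int (card (?K (n - 1))))" for n
  proof (cases n)
    case 0
    then show ?thesis
      by (simp add: K)
  next
    case (Suc k)
    have "{c \<in> conjugacy_classes G. class_weight G S \<omega> c = n} = ?K n - ?K k"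
      unfolding K by (auto simp: Suc)
    moreover have "?K k \<subseteq> ?K n"
      unfolding K by (auto simp: Suc)
    ultimately show ?thesis
      using finite_conj_classes[of n] Suc by (simp add: card_Diff_subset finite_subset card_mono of_nat_diff)
  qed
  then have "conjugacy_growth_series G S \<omega> = fps_of_poly (1 - monom 1 1) * Abs_fps (\<lambda>n. int (card (?K n)))"
    by (simp add: conjugacy_growth_series_def fps_eq_iff fps_of_poly_diff fps_of_poly_monom' left_diff_distrib)
  then show ?thesis
    by (simp add: rational_fps_mult_poly rational_cumulative_series)
qed

end

theorem theorem3:
  fixes G :: "('a, 'b) monoid_scheme"
    and S :: "'a set"
    and \<omega> :: "'a \<Rightarrow> nat"
  assumes "group G"
    and "virtually_abelian G"
    and "finite_generating_set G S"
    and "\<forall>s \<in> S. 1 \<le> \<omega> s"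
  shows "rational_fps (conjugacy_growth_series G S \<omega>)"
proof -
  interpret group G by fact
  obtain H where H: "subgroup H G" "comm_group (G\<lparr>carrier := H\<rparr>)" "finite (rcosets\<^bsub>G\<^esub> H)"
    using assms(2) unfolding virtually_abelian_def by blast
  \<comment> \<open>H need not be normal. Its core is normal, still has finite index, and is abelian
    as a subset of H.\<close>
  obtain A where A: "A \<lhd> G" "A \<subseteq> H" "finite (rcosets\<^bsub>G\<^esub> A)"
    using normal_core_finite_index[OF H(1,3)] by blast
  define T where "T = (\<lambda>c. SOME g. g \<in> carrier G \<and> A #>\<^bsub>G\<^esub> g = c) ` (rcosets\<^bsub>G\<^esub> A)"
  have some: "(SOME g. g \<in> carrier G \<and> A #>\<^bsub>G\<^esub> g = c) \<in> carrier G"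
      "A #>\<^bsub>G\<^esub> (SOME g. g \<in> carrier G \<and> A #>\<^bsub>G\<^esub> g = c) = c" if "c \<in> rcosets\<^bsub>G\<^esub> A" for c
  proof -
    have "\<exists>g. g \<in> carrier G \<and> A #>\<^bsub>G\<^esub> g = c"
      using that unfolding RCOSETS_def by blast
    from someI_ex[OF this] show "(SOME g. g \<in> carrier G \<and> A #>\<^bsub>G\<^esub> g = c) \<in> carrier G"
      "A #>\<^bsub>G\<^esub> (SOME g. g \<in> carrier G \<and> A #>\<^bsub>G\<^esub> g = c) = c"
      by blast+
  qed
  have "weighted_generators A G T S \<omega>"
  proof (intro weighted_generators.intro abelian_transversal.intro abelian_transversal_axioms.intro
      weighted_generators_axioms.intro A(1))
    show "x \<otimes>\<^bsub>G\<^esub> y = y \<otimes>\<^bsub>G\<^esub> x" if "x \<in> A" "y \<in> A" for x y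
      using comm_monoid.m_comm[OF comm_group.axioms(1)[OF H(2)], of x y] that A(2) by auto
    show "finite T"
      using A(3) by (simp add: T_def)
    show "T \<subseteq> carrier G"
      using some(1) by (auto simp: T_def)
    show "\<exists>!t. t \<in> T \<and> A #>\<^bsub>G\<^esub> t = A #>\<^bsub>G\<^esub> g" if g: "g \<in> carrier G" for g
    proof -
      have "A #>\<^bsub>G\<^esub> g \<in> rcosets\<^bsub>G\<^esub> A"
        using g unfolding RCOSETS_def by blast
      then show ?thesis
        using some(2) by (intro ex1I[of _ "SOME h. h \<in> carrier G \<and> A #>\<^bsub>G\<^esub> h = A #>\<^bsub>G\<^esub> g"])
          (auto simp: T_def)
    qed
  qed (use assms(3,4) in \<open>auto simp: finite_generating_set_def\<close>)
  then interpret weighted_generators A G T S \<omega> .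
  show ?thesis
    using assms(3) by (intro rational_conjugacy_growth_series) (auto simp: finite_generating_set_def)
qed

end
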